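(* Let $H$ be a complex Hilbert space and $K$ a finite-dimensional complex Hilbert space. The metric space $(C(H,K),d)$ is metrically convex.
   Context: $C(H,K)$ is the set of all closed densely-defined linear operators from $H$ to $K$. For $T,X\in C(H,K)$ put $L_T(X)=(I+T^*T)^{1/2}X^*-T^*(I+XX^* )^{1/2}$ and $R_T(X)=(I+XX^* )^{1/2}(I+TT^* )^{1/2}-XT^*$. The metric is $d(T,S)=\tanh^{-1}\|L_T(S)R_S(T)^{-1}\|$ (for $\dim K<\infty$ the inverse exists and $d$ is a metric on $C(H,K)$). A metric space $(M,\rho)$ is metrically convex if for any two distinct points $p,q\in M$ there exists at least one point $r\in M$, $r\neq p$, $r\neq q$, which is metrically between $p$ and $q$, i.e. $\rho(p,q)=\rho(p,r)+\rho(r,q)$. *)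

theory Defs
  imports "HOL-Analysis.Analysis"
begin

section \<open>Complex Hilbert spaces\<close>

text \<open>
  A complex inner product space is a real one (with inner product the real part of the complex
  one) carrying a compatible complex structure. Definiteness of \<open>cinner\<close> and
  \<open>norm x = sqrt (Re (cinner x x))\<close> thus come from \<^class>\<open>real_inner\<close>.
  The complex inner product is linear in its first and antilinear in its second argument.
\<close>

class complex_inner = real_inner +
  fixes scaleC :: "complex \<Rightarrow> 'a \<Rightarrow> 'a" (infixr "*\<^sub>C" 75)
    and cinner :: "'a \<Rightarrow> 'a \<Rightarrow> complex"
  assumes scaleC_add_right: "c *\<^sub>C (x + y) = c *\<^sub>C x + c *\<^sub>C y"
    and scaleC_add_left: "(c + d) *\<^sub>C x = c *\<^sub>C x + d *\<^sub>C x"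
    and scaleC_scaleC: "c *\<^sub>C d *\<^sub>C x = (c * d) *\<^sub>C x"
    and scaleC_one: "1 *\<^sub>C x = x"
    and scaleR_scaleC: "r *\<^sub>R x = complex_of_real r *\<^sub>C x"
    and cinner_add_left: "cinner (x + y) z = cinner x z + cinner y z"
    and cinner_scaleC_left: "cinner (c *\<^sub>C x) y = c * cinner x y"
    and cinner_commute: "cinner x y = cnj (cinner y x)"
    and inner_eq_Re_cinner: "inner x y = Re (cinner x y)"

class chilbert_space = complex_inner + complete_space

instantiation complex :: chilbert_space
begin

definition scaleC_complex :: "complex \<Rightarrow> complex \<Rightarrow> complex" where
  "scaleC_complex c x = c * x"

definition cinner_complex :: "complex \<Rightarrow> complex \<Rightarrow> complex" where
  "cinner_complex x y = x * cnj y"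

instance
  by standard
    (auto simp: scaleC_complex_def cinner_complex_def algebra_simps scaleR_conv_of_real
      inner_complex_def)

end

lemma vector_space_scaleC: "vector_space (scaleC :: complex \<Rightarrow> 'a \<Rightarrow> 'a::complex_inner)"
  by unfold_locales (rule scaleC_add_right scaleC_add_left scaleC_scaleC scaleC_one)+


section \<open>Unbounded operators\<close>

text \<open>
  A possibly unbounded operator from \<open>H\<close> to \<open>K\<close> is identified with its graph, so that
  \<^term>\<open>Domain A\<close> is its domain and \<^term>\<open>A\<inverse>\<close> the graph of its inverse. Sums, differences
  and products have their natural domains; note that \<^term>\<open>B O A\<close> is the graph
  of the operator product \<open>A B\<close> (first \<open>B\<close>, then \<open>A\<close>).
\<close>

definition linear_op :: "('h::complex_inner \<times> 'k::complex_inner) set \<Rightarrow> bool" where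
  "linear_op A \<longleftrightarrow> single_valued A \<and> (0, 0) \<in> A \<and>
     (\<forall>x y x' y'. (x, y) \<in> A \<longrightarrow> (x', y') \<in> A \<longrightarrow> (x + x', y + y') \<in> A) \<and>
     (\<forall>c x y. (x, y) \<in> A \<longrightarrow> (c *\<^sub>C x, c *\<^sub>C y) \<in> A)"

definition densely_defined :: "('h::complex_inner \<times> 'k::complex_inner) set \<Rightarrow> bool" where
  "densely_defined A \<longleftrightarrow> closure (Domain A) = UNIV"

definition closed_ops :: "('h::complex_inner \<times> 'k::complex_inner) set set" where
  "closed_ops = {A. linear_op A \<and> closed A \<and> densely_defined A}"

definition op_plus ::
    "('h \<times> 'k) set \<Rightarrow> ('h \<times> 'k) set \<Rightarrow> ('h::complex_inner \<times> 'k::complex_inner) set"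
    (infixl "\<oplus>\<^sub>o" 65) where
  "A \<oplus>\<^sub>o B = {(x, y + z) | x y z. (x, y) \<in> A \<and> (x, z) \<in> B}"

definition op_minus ::
    "('h \<times> 'k) set \<Rightarrow> ('h \<times> 'k) set \<Rightarrow> ('h::complex_inner \<times> 'k::complex_inner) set"
    (infixl "\<ominus>\<^sub>o" 65) where
  "A \<ominus>\<^sub>o B = {(x, y - z) | x y z. (x, y) \<in> A \<and> (x, z) \<in> B}"

abbreviation op_times :: "('b \<times> 'c) set \<Rightarrow> ('a \<times> 'b) set \<Rightarrow> ('a \<times> 'c) set"
    (infixl "\<odot>\<^sub>o" 70) where
  "A \<odot>\<^sub>o B \<equiv> B O A"

definition adj :: "('h::complex_inner \<times> 'k::complex_inner) set \<Rightarrow> ('k \<times> 'h) set" where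
  "adj A = {(y, z). \<forall>(x, w) \<in> A. cinner w y = cinner x z}"

definition positive_selfadjoint :: "('h::complex_inner \<times> 'h) set \<Rightarrow> bool" where
  "positive_selfadjoint A \<longleftrightarrow> linear_op A \<and> densely_defined A \<and> adj A = A \<and>
     (\<forall>(x, y) \<in> A. cinner y x \<in> \<real>\<^sub>\<ge>\<^sub>0)"

text \<open>A positive self-adjoint operator has exactly one positive self-adjoint square root.\<close>

definition op_sqrt :: "('h::complex_inner \<times> 'h) set \<Rightarrow> ('h \<times> 'h) set" where
  "op_sqrt A = (THE S. positive_selfadjoint S \<and> S \<odot>\<^sub>o S = A)"

definition op_norm :: "('h::complex_inner \<times> 'k::complex_inner) set \<Rightarrow> real" where
  "op_norm A = Sup {norm y | x y. (x, y) \<in> A \<and> norm x \<le> 1}"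


section \<open>The metric on the closed densely defined operators\<close>

definition L_op :: "('h::complex_inner \<times> 'k::complex_inner) set \<Rightarrow> ('h \<times> 'k) set \<Rightarrow> ('k \<times> 'h) set"
  where
  "L_op T X = op_sqrt (Id \<oplus>\<^sub>o adj T \<odot>\<^sub>o T) \<odot>\<^sub>o adj X \<ominus>\<^sub>o adj T \<odot>\<^sub>o op_sqrt (Id \<oplus>\<^sub>o X \<odot>\<^sub>o adj X)"

definition R_op :: "('h::complex_inner \<times> 'k::complex_inner) set \<Rightarrow> ('h \<times> 'k) set \<Rightarrow> ('k \<times> 'k) set"
  where
  "R_op T X =
     op_sqrt (Id \<oplus>\<^sub>o X \<odot>\<^sub>o adj X) \<odot>\<^sub>o op_sqrt (Id \<oplus>\<^sub>o T \<odot>\<^sub>o adj T) \<ominus>\<^sub>o X \<odot>\<^sub>o adj T"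

text \<open>
  The value off \<^const>\<open>closed_ops\<close> is irrelevant; it is set to 0 because \<^locale>\<open>Metric_space\<close>
  demands nonnegativity and symmetry of the distance function on the whole type.
\<close>

definition op_dist ::
    "('h::complex_inner \<times> 'k::complex_inner) set \<Rightarrow> ('h \<times> 'k) set \<Rightarrow> real" where
  "op_dist T S =
     (if T \<in> closed_ops \<and> S \<in> closed_ops
      then artanh (op_norm (L_op T S \<odot>\<^sub>o (R_op S T)\<inverse>)) else 0)"

definition metrically_convex :: "'a set \<Rightarrow> ('a \<Rightarrow> 'a \<Rightarrow> real) \<Rightarrow> bool" where
  "metrically_convex M \<rho> \<longleftrightarrow> Metric_space M \<rho> \<and>
     (\<forall>p\<in>M. \<forall>q\<in>M. p \<noteq> q \<longrightarrow>
        (\<exists>r\<in>M. r \<noteq> p \<and> r \<noteq> q \<and> \<rho> p q = \<rho> p r + \<rho> r q))"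

end

theory Submission
  imports Defs
begin

text \<open>
  Since \<open>K\<close> is finite-dimensional, every closed densely defined operator \<open>T\<close> from \<open>H\<close> to \<open>K\<close> is
  bounded, and \<open>W_T = ((I + TT*)\<^sup>1\<^sup>/\<^sup>2, T*)\<close> embeds \<open>K\<close> isometrically into \<open>K \<oplus> H\<close> with the indefinite
  form \<open>[(a, b), (a', b')] = \<langle>a, a'\<rangle> - \<langle>b, b'\<rangle>\<close>, that is, into an operator version of the hyperboloid
  model. There \<open>R_S(T) = W_T\<^sup>* W_S\<close> (adjoint with respect to the form) and \<open>R*R = I + L*L\<close>,
  whence \<open>d(T, S) = arsinh \<parallel>L\<parallel>\<close>, and \<open>d(T, S) \<le> r\<close> means \<open>\<parallel>R x\<parallel> \<le> cosh r \<parallel>x\<parallel>\<close>. The triangle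
  inequality is the addition theorem of \<open>cosh\<close>. For the midpoint of \<open>T\<close> and \<open>S\<close> take the unitary
  \<open>Q\<close> with \<open>P = R Q\<close> positive; the sum \<open>W_T + W_S Q\<close> has Gram operator \<open>2 (I + P)\<close>, and after
  normalisation both distances are governed by \<open>((1 + cosh d(T, S)) / 2)\<^sup>1\<^sup>/\<^sup>2 = cosh (d(T, S) / 2)\<close>.
\<close>

subclass (in chilbert_space) banach ..

section \<open>Square roots of positive definite operators\<close>

definition adjoint_pair :: "('a::real_inner \<Rightarrow> 'b::real_inner) \<Rightarrow> ('b \<Rightarrow> 'a) \<Rightarrow> bool" where
  "adjoint_pair f g \<longleftrightarrow> (\<forall>x y. inner (f x) y = inner x (g y))"

definition pos_definite :: "('a::real_inner \<Rightarrow> 'a) \<Rightarrow> bool" where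
  "pos_definite f \<longleftrightarrow> (\<exists>e>0. \<forall>x. e * inner x x \<le> inner (f x) x)"

lemma adjoint_pairD: "adjoint_pair f g \<Longrightarrow> inner (f x) y = inner x (g y)"
  by (simp add: adjoint_pair_def)

lemma adjoint_pairD': "adjoint_pair f g \<Longrightarrow> inner (g y) x = inner y (f x)"
  by (simp add: adjoint_pair_def inner_commute)

lemma adjoint_pair_sym: "adjoint_pair f g \<Longrightarrow> adjoint_pair g f"
  by (simp add: adjoint_pair_def inner_commute)

lemma adjoint_pair_bound:
  assumes fg: "adjoint_pair f g" and f: "\<And>x. norm (f x) \<le> c * norm x" and c: "0 \<le> c"
  shows "norm (g y) \<le> c * norm y"
proof (cases "g y = 0")
  case False
  have "norm (g y) * norm (g y) = inner (f (g y)) y"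
    using fg by (simp add: adjoint_pairD flip: power2_norm_eq_inner power2_eq_square)
  also have "\<dots> \<le> norm (f (g y)) * norm y" by (rule norm_cauchy_schwarz)
  also have "\<dots> \<le> (c * norm (g y)) * norm y" by (intro mult_right_mono f) simp
  finally have "norm (g y) * norm (g y) \<le> norm (g y) * (c * norm y)" by (simp add: mult_ac)
  with False show ?thesis by simp
qed (use c in simp)

lemma pos_definite_nonneg: "pos_definite f \<Longrightarrow> 0 \<le> inner (f x) x"
  unfolding pos_definite_def by (meson inner_ge_zero less_imp_le mult_nonneg_nonneg order_trans)

lemma pos_definite_injective:
  assumes "pos_definite f" "f x = 0"
  shows "x = 0"
  using assms unfolding pos_definite_def
  by (metis inner_gt_zero_iff inner_zero_left mult_pos_pos not_le)

lemma pos_definite_sqrt_exists: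
  fixes A :: "'a::{real_inner,banach} \<Rightarrow>\<^sub>L 'a"
  assumes sym: "adjoint_pair A A" and pos: "pos_definite A"
  obtains C :: "'a \<Rightarrow>\<^sub>L 'a" where "adjoint_pair C C" "pos_definite C" "\<And>x. C (C x) = A x"
    "\<And>M :: 'a \<Rightarrow>\<^sub>L 'a. (\<And>x. M (A x) = A (M x)) \<Longrightarrow> (\<And>x. M (C x) = C (M x))"
proof -
  obtain e where e: "e > 0" "\<And>x. e * inner x x \<le> inner (A x) x"
    using pos unfolding pos_definite_def by blast
  define c where "c = ((norm A)\<^sup>2 + e\<^sup>2) / e"
  have c: "c > 0" "(norm A)\<^sup>2 \<le> c * e"
    using e(1) unfolding c_def by (auto simp: add_nonneg_pos)
  have ce: "e \<le> c" using e(1) by (simp add: c_def field_simps power2_eq_square)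
  define b where "b = sqrt (1 - e / c)"
  have b: "0 \<le> b" "b < 1" "b\<^sup>2 = 1 - e / c"
    using c e ce unfolding b_def by (auto simp: field_simps)
  define B where "B = id_blinfun - (1 / c) *\<^sub>R A"
  have B_app: "B x = x - (1/c) *\<^sub>R A x" for x
    by (simp add: B_def blinfun.diff_left blinfun.scaleR_left)
  have normB: "norm B \<le> b"
  proof (rule norm_blinfun_bound[OF b(1)])
    fix x
    have "norm (A x) \<le> norm A * norm x" by (rule norm_blinfun)
    then have "(norm (A x))\<^sup>2 \<le> (norm A * norm x)\<^sup>2" by (intro power_mono) auto
    then have "(norm (A x))\<^sup>2 \<le> (c * e) * (norm x)\<^sup>2"
      using c(2) by (smt (verit) power_mult_distrib mult_right_mono zero_le_power2)
    then have h: "(norm (A x))\<^sup>2 / c\<^sup>2 \<le> e / c * (norm x)\<^sup>2"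
      using c by (simp add: field_simps power2_eq_square)
    have "(norm (B x))\<^sup>2 = (norm x)\<^sup>2 - 2 / c * inner (A x) x + (norm (A x))\<^sup>2 / c\<^sup>2"
      unfolding B_app power2_norm_eq_inner
      by (simp add: inner_diff_left inner_diff_right inner_commute power2_eq_square field_simps)
    also have "\<dots> \<le> (norm x)\<^sup>2 - 2 / c * (e * (norm x)\<^sup>2) + e / c * (norm x)\<^sup>2"
      using h e(2)[of x] c by (intro add_mono diff_mono mult_left_mono) (auto simp: power2_norm_eq_inner)
    also have "\<dots> = (b * norm x)\<^sup>2"
      by (simp add: power_mult_distrib b(3) algebra_simps)
    finally show "norm (B x) \<le> b * norm x"
      by (rule power2_le_imp_le) (simp add: b(1))
  qed
  define r where "r = 1 - sqrt (1 - b)"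
  have r: "0 \<le> r" "r < 1" "(b + r\<^sup>2) / 2 = r"
    using b(1,2) by (auto simp: r_def power2_eq_square field_simps)
  define S where "S = {X :: 'a \<Rightarrow>\<^sub>L 'a. norm X \<le> r \<and>
     (\<forall>x y. inner (blinfun_apply X x) y = inner x (blinfun_apply X y)) \<and>
     (\<forall>M::'a \<Rightarrow>\<^sub>L 'a. (\<forall>x. blinfun_apply M (B x) = B (M x)) \<longrightarrow> (\<forall>x. blinfun_apply M (blinfun_apply X x) = blinfun_apply X (M x)))}"
  define F :: "('a \<Rightarrow>\<^sub>L 'a) \<Rightarrow> 'a \<Rightarrow>\<^sub>L 'a" where "F X = (1/2) *\<^sub>R (B + (X o\<^sub>L X))" for X
  have F_app: "F X x = (1/2) *\<^sub>R (B x + X (X x))" for X x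
    by (simp add: F_def blinfun.add_left blinfun.scaleR_left)
  have "closed S"
    unfolding S_def
    by (intro closed_Collect_conj closed_Collect_all closed_Collect_imp closed_Collect_eq
         closed_Collect_le open_Collect_const continuous_intros)
  then have "complete S" by (simp add: complete_eq_closed)
  moreover have "0 \<in> S" by (simp add: S_def r(1))
  moreover have "F ` S \<subseteq> S"
  proof safe
    fix X assume X: "X \<in> S"
    have "norm (B + (X o\<^sub>L X)) \<le> b + r * r"
    proof -
      have "norm X \<le> r" using X unfolding S_def by blast
      then show ?thesis
        using norm_triangle_ineq[of B "X o\<^sub>L X"] norm_blinfun_compose[of X X] normB
          mult_mono[of "norm X" r "norm X" r] r(1) by simp
    qed
    then have "norm (F X) \<le> r"
      using r(3) by (simp add: F_def power2_eq_square)
    moreover have "inner (B x) y = inner x (B y)" for x y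
      by (simp add: B_app inner_diff_left inner_diff_right adjoint_pairD[OF sym])
    moreover have Xsym: "inner (X x) y = inner x (X y)" for x y
      using X unfolding S_def by blast
    ultimately have 1: "norm (F X) \<le> r" "inner (F X x) y = inner x (F X y)" for x y
      by (simp_all add: F_app inner_add_left inner_add_right)
    have 2: "M (F X x) = F X (M x)" if M: "\<forall>x. M (B x) = B (M x)" for M :: "'a \<Rightarrow>\<^sub>L 'a" and x
    proof -
      have "M (X x) = X (M x)" for x using X M unfolding S_def by blast
      then have "M (X (X x)) = X (X (M x))" by metis
      with M show ?thesis by (simp add: F_app blinfun.bilinear_simps)
    qed
    show "F X \<in> S" using 1 2 unfolding S_def by blast
  qed
  moreover have "dist (F X) (F Y) \<le> r * dist X Y" if "X \<in> S" "Y \<in> S" for X Y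
  proof -
    have "F X - F Y = (1/2) *\<^sub>R ((X o\<^sub>L (X - Y)) + ((X - Y) o\<^sub>L Y))"
      by (rule blinfun_eqI) (simp add: F_app blinfun.bilinear_simps algebra_simps)
    also have "norm \<dots> \<le> (1/2) * (norm X * norm (X - Y) + norm (X - Y) * norm Y)"
      using norm_triangle_ineq[of "X o\<^sub>L (X - Y)" "(X - Y) o\<^sub>L Y"]
        norm_blinfun_compose[of X "X - Y"] norm_blinfun_compose[of "X - Y" Y] by simp
    also have "\<dots> \<le> (1/2) * (r * norm (X - Y) + norm (X - Y) * r)"
    proof -
      have "norm X \<le> r" "norm Y \<le> r" using that unfolding S_def by blast+
      then show ?thesis by (intro mult_left_mono add_mono mult_right_mono) auto
    qed
    finally show ?thesis by (simp add: dist_norm mult.commute)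
  qed
  ultimately have "\<exists>!X\<in>S. F X = X"
    using r by (intro Banach_fix) auto
  then obtain X where X: "X \<in> S" "F X = X" by blast
  have Xr: "norm X \<le> r" and Xsym: "inner (X x) y = inner x (X y)" for x y
    using X(1) unfolding S_def by blast+
  have XX: "X (X x) = 2 *\<^sub>R X x - B x" for x
  proof -
    have "2 *\<^sub>R X x = 2 *\<^sub>R F X x" unfolding X(2) ..
    also have "\<dots> = B x + X (X x)" unfolding F_app by simp
    finally show ?thesis by (simp add: algebra_simps)
  qed
  define C where "C = sqrt c *\<^sub>R (id_blinfun - X)"
  have C_app: "C x = sqrt c *\<^sub>R (x - X x)" for x
    by (simp add: C_def blinfun.diff_left blinfun.scaleR_left)
  show thesis
  proof
    show "adjoint_pair C C"
      by (simp add: adjoint_pair_def C_app Xsym inner_diff_left inner_diff_right)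
    show "pos_definite C"
      unfolding pos_definite_def
    proof (intro exI conjI allI)
      show "sqrt c * (1 - r) > 0" using c r by simp
      fix x
      have "inner (X x) x \<le> norm (X x) * norm x" by (rule norm_cauchy_schwarz)
      also have "\<dots> \<le> (r * norm x) * norm x"
        using norm_blinfun[of X x] mult_right_mono[OF Xr, of "norm x"]
        by (intro mult_right_mono) auto
      finally have "inner (X x) x \<le> r * inner x x"
        by (simp add: power2_norm_eq_inner[symmetric] power2_eq_square)
      then have "(1 - r) * inner x x \<le> inner (x - X x) x"
        by (simp add: inner_diff_left algebra_simps)
      then show "sqrt c * (1 - r) * inner x x \<le> inner (C x) x"
        using c by (simp add: C_app mult.assoc)
    qed
    show "C (C x) = A x" for x
      using c XX[of x] by (simp add: C_app blinfun.bilinear_simps scaleR_diff_right[symmetric] B_app scaleR_2 del: scaleR_diff_right)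
    show "M (C x) = C (M x)" if "\<And>x. M (A x) = A (M x)" for M :: "'a \<Rightarrow>\<^sub>L 'a" and x
    proof -
      have "M (B x) = B (M x)" for x by (simp add: B_app blinfun.bilinear_simps that)
      then have "M (X x) = X (M x)" using X(1) unfolding S_def by blast
      then show ?thesis by (simp add: C_app blinfun.bilinear_simps)
    qed
  qed
qed

lemma pos_definite_sqrt_unique:
  fixes A C D :: "'a::{real_inner,banach} \<Rightarrow>\<^sub>L 'a"
  assumes A: "adjoint_pair A A" "pos_definite A"
    and C: "\<And>x. 0 \<le> inner (C x) x" "\<And>x. C (C x) = A x"
    and D: "\<And>x. 0 \<le> inner (D x) x" "\<And>x. D (D x) = A x"
  shows "C = D"
proof -
  obtain Q :: "'a \<Rightarrow>\<^sub>L 'a" where Q: "pos_definite Q" "\<And>x. Q (Q x) = A x"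
    and commutant: "\<And>(M :: 'a \<Rightarrow>\<^sub>L 'a) x. (\<And>x. M (A x) = A (M x)) \<Longrightarrow> M (Q x) = Q (M x)"
    using pos_definite_sqrt_exists[OF A] by metis
  obtain e where e: "e > 0" "\<And>x. e * inner x x \<le> inner (Q x) x"
    using Q(1) unfolding pos_definite_def by blast
  have "S = Q" if S: "\<And>x. 0 \<le> inner (S x) x" "\<And>x. S (S x) = A x" for S :: "'a \<Rightarrow>\<^sub>L 'a"
  proof (rule blinfun_eqI)
    fix x
    have SQ: "S (Q z) = Q (S z)" for z
      by (rule commutant) (metis S(2))
    define y where "y = S x - Q x"
    have "S y + Q y = 0"
      by (simp add: y_def blinfun.bilinear_simps S(2) Q(2) SQ)
    then have "inner (S y) y + inner (Q y) y = 0"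
      by (simp flip: inner_add_left)
    with S(1)[of y] e(2)[of y] have "e * inner y y \<le> 0" by linarith
    with e(1) have "y = 0"
      by (metis inner_gt_zero_iff mult_pos_pos not_le)
    then show "S x = Q x" by (simp add: y_def)
  qed
  with C D show ?thesis by metis
qed

text \<open>
  The difference \<open>E\<close> of both sides solves the Sylvester equation \<open>d E + E c = 0\<close>, which has only
  the trivial solution for positive definite \<open>c\<close> and \<open>d\<close>.
\<close>
lemma defect_roots_intertwine:
  fixes c :: "'b::{real_inner,banach} \<Rightarrow>\<^sub>L 'b" and d :: "'a::{real_inner,banach} \<Rightarrow>\<^sub>L 'a"
    and t :: "'a \<Rightarrow>\<^sub>L 'b" and t' :: "'b \<Rightarrow>\<^sub>L 'a"
  assumes tt': "adjoint_pair t t'"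
    and c: "adjoint_pair c c" "pos_definite c" "\<And>x. c (c x) = x + t (t' x)"
    and d: "adjoint_pair d d" "pos_definite d" "\<And>x. d (d x) = x + t' (t x)"
  shows "d (t' x) = t' (c x)"
proof -
  define E where "E = (d o\<^sub>L t') - (t' o\<^sub>L c)"
  define E' where "E' = (t o\<^sub>L d) - (c o\<^sub>L t)"
  define F where "F = E' o\<^sub>L E"
  have E: "E x = d (t' x) - t' (c x)" for x by (simp add: E_def blinfun.diff_left)
  have E': "E' x = t (d x) - c (t x)" for x by (simp add: E'_def blinfun.diff_left)
  have F: "F x = E' (E x)" for x by (simp add: F_def)
  have EE': "inner (E' x) y = inner x (E y)" for x y
    by (simp add: E E' inner_diff_left inner_diff_right adjoint_pairD[OF tt'] adjoint_pairD[OF c(1)]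
         adjoint_pairD[OF d(1)])
  have dE: "d (E x) = - E (c x)" for x
    by (simp add: E blinfun.bilinear_simps c d)
  have cE': "c (E' x) = - E' (d x)" for x
    by (simp add: E' blinfun.bilinear_simps c d)
  have Fc: "F (c x) = c (F x)" for x
    using dE[of x] by (simp add: F cE' blinfun.minus_right)
  obtain g :: "'b \<Rightarrow>\<^sub>L 'b" where g: "adjoint_pair g g" "\<And>x. g (g x) = c x"
    "\<And>(M :: 'b \<Rightarrow>\<^sub>L 'b) x. (\<And>x. M (c x) = c (M x)) \<Longrightarrow> M (g x) = g (M x)"
    using pos_definite_sqrt_exists[OF c(1,2)] by metis
  obtain e where e: "e > 0" "\<And>x. e * inner x x \<le> inner (d x) x"
    using d(2) unfolding pos_definite_def by blast
  have "inner (F (c x)) x = inner (E (g x)) (E (g x))" for x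
    by (metis F EE' g Fc adjoint_pairD)
  moreover have "inner (F (c x)) x = - inner (d (E x)) (E x)" for x
    using dE[of x] by (simp add: F EE')
  ultimately have "e * inner (E x) (E x) \<le> 0"
    using e(2)[of "E x"] by (smt (verit) inner_ge_zero)
  with e(1) have "E x = 0"
    by (metis inner_gt_zero_iff mult_pos_pos not_le)
  then show ?thesis by (simp add: E)
qed

section \<open>Complex-linear operators\<close>

lemma cinner_scaleC_right: "cinner x (c *\<^sub>C y) = cnj c * cinner x y"
  by (metis cinner_commute cinner_scaleC_left complex_cnj_mult)

lemma cinner_add_right: "cinner x (y + z) = cinner x y + cinner x z"
  by (metis cinner_commute cinner_add_left complex_cnj_add)

lemma cinner_zero_left [simp]: "cinner 0 x = 0"
  using cinner_add_left[of 0 0 x] by simp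

lemma cinner_zero_right [simp]: "cinner x 0 = 0"
  using cinner_add_right[of x 0 0] by simp

lemma cinner_diff_left: "cinner (x - y) z = cinner x z - cinner y z"
  using cinner_add_left[of "x - y" y z] by simp

lemma cinner_diff_right: "cinner z (x - y) = cinner z x - cinner z y"
  using cinner_add_right[of z "x - y" y] by simp

lemma cinner_self: "cinner x x = complex_of_real ((norm x)\<^sup>2)"
proof (rule complex_eqI)
  show "Im (cinner x x) = Im (complex_of_real ((norm x)\<^sup>2))"
    using arg_cong[OF cinner_commute[of x x], of Im] by simp
qed (simp add: power2_norm_eq_inner inner_eq_Re_cinner)

lemma norm_scaleC: "norm (c *\<^sub>C x) = cmod c * norm x" for x :: "'a::complex_inner"
proof -
  have "complex_of_real ((norm (c *\<^sub>C x))\<^sup>2) = complex_of_real ((cmod c * norm x)\<^sup>2)"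
    unfolding cinner_self[symmetric] cinner_scaleC_left cinner_scaleC_right
    unfolding cinner_self by (simp add: power_mult_distrib mult.commute flip: complex_norm_square)
  then have "(norm (c *\<^sub>C x))\<^sup>2 = (cmod c * norm x)\<^sup>2"
    using of_real_eq_iff by blast
  then show ?thesis by simp
qed

lemma cinner_eqI: "(\<And>y. cinner x y = cinner z y) \<Longrightarrow> x = z" for x :: "'a::complex_inner"
  by (metis inner_eq_Re_cinner vector_eq_rdot)

lemma norm_cinner_le: "cmod (cinner x y) \<le> norm x * norm y" for x :: "'a::complex_inner"
proof (cases "cinner x y = 0")
  case False
  define u where "u = cnj (sgn (cinner x y))"
  have "cmod u = 1" using False by (simp add: u_def norm_sgn)
  have "u * cinner x y = complex_of_real (cmod (cinner x y))"
    using False unfolding u_def by (simp add: sgn_eq complex_norm_square[symmetric] field_simps power2_eq_square flip: of_real_mult)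
  then have "cmod (cinner x y) = inner (u *\<^sub>C x) y"
    by (simp add: inner_eq_Re_cinner cinner_scaleC_left)
  also have "\<dots> \<le> norm (u *\<^sub>C x) * norm y" by (rule norm_cauchy_schwarz)
  finally show ?thesis by (simp add: norm_scaleC \<open>cmod u = 1\<close>)
qed simp

lemma bounded_linear_scaleC: "bounded_linear (\<lambda>x::'a::complex_inner. c *\<^sub>C x)"
proof (rule bounded_linear_intro[where K = "cmod c"])
  show "c *\<^sub>C (r *\<^sub>R x) = r *\<^sub>R (c *\<^sub>C x)" for r and x :: 'a
    by (simp add: scaleR_scaleC scaleC_scaleC mult.commute)
qed (simp_all add: scaleC_add_right norm_scaleC mult.commute)

definition complex_linear :: "('a::complex_inner \<Rightarrow> 'b::complex_inner) \<Rightarrow> bool" where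
  "complex_linear f \<longleftrightarrow> (\<forall>c x. f (c *\<^sub>C x) = c *\<^sub>C f x)"

lemma complex_linearD: "complex_linear f \<Longrightarrow> f (c *\<^sub>C x) = c *\<^sub>C f x"
  by (simp add: complex_linear_def)

lemma scaleC_diff_right: "c *\<^sub>C (x - y) = c *\<^sub>C x - c *\<^sub>C y" for x y :: "'a::complex_inner"
  by (metis add_diff_cancel diff_add_cancel scaleC_add_right)

lemma adjoint_pair_cinner:
  assumes "adjoint_pair f g" "complex_linear f"
  shows "cinner (f x) y = cinner x (g y)"
proof (rule complex_eqI)
  show "Re (cinner (f x) y) = Re (cinner x (g y))"
    using adjoint_pairD[OF assms(1), of x y] by (simp add: inner_eq_Re_cinner)
  show "Im (cinner (f x) y) = Im (cinner x (g y))"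
    using adjoint_pairD[OF assms(1), of "- \<i> *\<^sub>C x" y]
    by (simp add: inner_eq_Re_cinner complex_linearD[OF assms(2)] cinner_scaleC_left)
qed

lemma pos_definite_csqrt_exists:
  fixes A :: "'a::chilbert_space \<Rightarrow>\<^sub>L 'a"
  assumes "adjoint_pair A A" "pos_definite A" "complex_linear A"
  obtains C :: "'a \<Rightarrow>\<^sub>L 'a"
  where "adjoint_pair C C" "pos_definite C" "complex_linear C" "\<And>x. C (C x) = A x"
proof -
  obtain C :: "'a \<Rightarrow>\<^sub>L 'a" where C: "adjoint_pair C C" "pos_definite C" "\<And>x. C (C x) = A x"
    "\<And>(M :: 'a \<Rightarrow>\<^sub>L 'a) x. (\<And>x. M (A x) = A (M x)) \<Longrightarrow> M (C x) = C (M x)"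
    using pos_definite_sqrt_exists[OF assms(1,2)] by metis
  have "C (c *\<^sub>C x) = c *\<^sub>C C x" for c x
    using C(4)[of "Blinfun (\<lambda>x. c *\<^sub>C x)" x]
    by (simp add: bounded_linear_Blinfun_apply bounded_linear_scaleC complex_linearD[OF assms(3)])
  then have "complex_linear C" unfolding complex_linear_def by blast
  then show thesis by (rule that[OF C(1,2) _ C(3)])
qed

definition defect_roots ::
    "('h::chilbert_space \<Rightarrow>\<^sub>L 'k::chilbert_space) \<Rightarrow> ('k \<Rightarrow>\<^sub>L 'h) \<Rightarrow> ('k \<Rightarrow>\<^sub>L 'k) \<Rightarrow> ('h \<Rightarrow>\<^sub>L 'h) \<Rightarrow> bool"
  where
  "defect_roots t t' c d \<longleftrightarrow> adjoint_pair t t' \<and> complex_linear t \<and> complex_linear t' \<and>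
     adjoint_pair c c \<and> pos_definite c \<and> complex_linear c \<and> (\<forall>x. c (c x) = x + t (t' x)) \<and>
     adjoint_pair d d \<and> pos_definite d \<and> complex_linear d \<and> (\<forall>x. d (d x) = x + t' (t x))"

lemma defect_rootsD:
  assumes "defect_roots t t' c d"
  shows "adjoint_pair t t'" "complex_linear t" "complex_linear t'"
    "adjoint_pair c c" "pos_definite c" "complex_linear c" "c (c x) = x + t (t' x)"
    "adjoint_pair d d" "pos_definite d" "complex_linear d" "d (d y) = y + t' (t y)"
    "d (t' x) = t' (c x)" "t (d y) = c (t y)"
proof -
  show 1: "adjoint_pair t t'" "complex_linear t" "complex_linear t'"
    "adjoint_pair c c" "pos_definite c" "complex_linear c" "c (c x) = x + t (t' x)"
    "adjoint_pair d d" "pos_definite d" "complex_linear d" "d (d y) = y + t' (t y)" for x y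
    using assms unfolding defect_roots_def by blast+
  show 2: "d (t' x) = t' (c x)" for x
    by (rule defect_roots_intertwine[OF 1(1,4,5,7,8,9,11)])
  have "inner (t (d y)) z = inner (c (t y)) z" for z
    by (simp add: adjoint_pairD[OF 1(1)] adjoint_pairD[OF 1(4)] adjoint_pairD[OF 1(8)] 2)
  then show "t (d y) = c (t y)" by (metis vector_eq_rdot)
qed

lemma defect_positive:
  fixes t :: "'a::chilbert_space \<Rightarrow>\<^sub>L 'b::chilbert_space" and t' :: "'b \<Rightarrow>\<^sub>L 'a"
  assumes "adjoint_pair t t'" "complex_linear t" "complex_linear t'"
  shows "adjoint_pair (id_blinfun + (t' o\<^sub>L t)) (id_blinfun + (t' o\<^sub>L t))"
    "pos_definite (id_blinfun + (t' o\<^sub>L t))" "complex_linear (id_blinfun + (t' o\<^sub>L t))"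
proof -
  show "pos_definite (id_blinfun + (t' o\<^sub>L t))"
    unfolding pos_definite_def
    by (rule exI[of _ 1])
      (simp add: blinfun.add_left inner_add_left adjoint_pairD'[OF assms(1)])
  show "adjoint_pair (id_blinfun + (t' o\<^sub>L t)) (id_blinfun + (t' o\<^sub>L t))"
    unfolding adjoint_pair_def
    by (simp add: blinfun.add_left inner_add_left inner_add_right
        adjoint_pairD[OF assms(1)] adjoint_pairD'[OF assms(1)])
  show "complex_linear (id_blinfun + (t' o\<^sub>L t))"
    using assms(2,3) by (simp add: complex_linear_def blinfun.add_left scaleC_add_right)
qed

lemma defect_roots_exist:
  fixes t :: "'a::chilbert_space \<Rightarrow>\<^sub>L 'b::chilbert_space" and t' :: "'b \<Rightarrow>\<^sub>L 'a"
  assumes "adjoint_pair t t'" "complex_linear t" "complex_linear t'"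
  obtains c :: "'b \<Rightarrow>\<^sub>L 'b" and d :: "'a \<Rightarrow>\<^sub>L 'a" where "defect_roots t t' c d"
proof -
  have 1: "adjoint_pair t' t" using assms adjoint_pair_sym by blast
  obtain c :: "'b \<Rightarrow>\<^sub>L 'b" where "adjoint_pair c c" "pos_definite c" "complex_linear c"
    "\<And>x. c (c x) = (id_blinfun + (t o\<^sub>L t')) x"
    using pos_definite_csqrt_exists[OF defect_positive[OF 1 assms(3,2)]] by metis
  moreover obtain d :: "'a \<Rightarrow>\<^sub>L 'a" where "adjoint_pair d d" "pos_definite d" "complex_linear d"
    "\<And>x. d (d x) = (id_blinfun + (t' o\<^sub>L t)) x"
    using pos_definite_csqrt_exists[OF defect_positive[OF assms]] by metis
  ultimately have "defect_roots t t' c d"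
    using assms by (simp add: defect_roots_def blinfun.add_left)
  then show thesis by (rule that)
qed

section \<open>Everywhere defined operators as graphs\<close>

definition op_graph :: "('a \<Rightarrow> 'b) \<Rightarrow> ('a \<times> 'b) set" where
  "op_graph f = range (\<lambda>x. (x, f x))"

lemma mem_op_graph [simp]: "(x, y) \<in> op_graph f \<longleftrightarrow> y = f x"
  by (auto simp: op_graph_def)

lemma op_graph_comp: "op_graph g \<odot>\<^sub>o op_graph f = op_graph (\<lambda>x. g (f x))"
  by (auto simp: relcomp_unfold)

lemma op_graph_plus: "op_graph f \<oplus>\<^sub>o op_graph g = op_graph (\<lambda>x. f x + g x)"
  by (auto simp: op_plus_def)

lemma op_graph_minus: "op_graph f \<ominus>\<^sub>o op_graph g = op_graph (\<lambda>x. f x - g x)"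
  by (auto simp: op_minus_def)

lemma Id_eq_op_graph: "Id = op_graph (\<lambda>x. x)"
  by auto

lemma op_graph_eq_iff [simp]: "op_graph f = op_graph g \<longleftrightarrow> f = g"
  by (metis ext mem_op_graph)

lemma Domain_op_graph [simp]: "Domain (op_graph f) = UNIV"
  by (auto simp: Domain_unfold)

lemma adj_op_graph:
  assumes "adjoint_pair f g" "complex_linear f"
  shows "adj (op_graph f) = op_graph g"
proof -
  have "(\<forall>x. cinner (f x) y = cinner x z) \<longleftrightarrow> z = g y" for y z
    unfolding adjoint_pair_cinner[OF assms]
    by (metis cinner_eqI cinner_commute)
  then show ?thesis by (auto simp: adj_def op_graph_def)
qed

lemma linear_op_graph:
  assumes "complex_linear f" "\<And>x y. f (x + y) = f x + f y" "f 0 = 0"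
  shows "linear_op (op_graph f)"
  using assms by (auto simp: linear_op_def single_valued_def complex_linear_def)

lemma op_graph_closed_ops:
  fixes t :: "'a::chilbert_space \<Rightarrow>\<^sub>L 'b::chilbert_space"
  assumes "complex_linear t"
  shows "op_graph t \<in> closed_ops"
proof -
  have "op_graph t = {p. t (fst p) = snd p}" by auto
  moreover have "closed {p. t (fst p) = snd p}"
    by (intro closed_Collect_eq continuous_intros)
  ultimately have "closed (op_graph t)" by simp
  with linear_op_graph[OF assms] show ?thesis
    by (simp add: closed_ops_def densely_defined_def blinfun.add_right)
qed

lemma positive_selfadjoint_op_graph:
  fixes c :: "'a::chilbert_space \<Rightarrow>\<^sub>L 'a"
  assumes c: "adjoint_pair c c" "complex_linear c" "\<And>x. 0 \<le> inner (c x) x"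
  shows "positive_selfadjoint (op_graph c)"
proof -
  have "cinner (c x) x = cnj (cinner (c x) x)" for x
    using adjoint_pair_cinner[OF c(1,2), of x x] cinner_commute[of x "c x"] by simp
  then have "Im (cinner (c x) x) = 0" for x
    by (metis Reals_cnj_iff complex_is_Real_iff)
  then have "cinner (c x) x \<in> \<real>\<^sub>\<ge>\<^sub>0" for x
    using c(3)[of x] by (simp add: complex_nonneg_Reals_iff inner_eq_Re_cinner)
  then show ?thesis
    using linear_op_graph[OF c(2)] adj_op_graph[OF c(1,2)]
    by (auto simp: positive_selfadjoint_def densely_defined_def blinfun.add_right)
qed

lemma positive_selfadjoint_root_bounded:
  fixes a :: "'a::chilbert_space \<Rightarrow>\<^sub>L 'a"
  assumes S: "positive_selfadjoint S" and SS: "S \<odot>\<^sub>o S = op_graph a"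
  obtains s :: "'a \<Rightarrow>\<^sub>L 'a" where "S = op_graph s" "\<And>x. 0 \<le> inner (s x) x" "\<And>x. s (s x) = a x"
proof -
  have sv: "single_valued S" and lin: "\<And>x y x' y'. (x, y) \<in> S \<Longrightarrow> (x', y') \<in> S \<Longrightarrow> (x + x', y + y') \<in> S"
    "\<And>c x y. (x, y) \<in> S \<Longrightarrow> (c *\<^sub>C x, c *\<^sub>C y) \<in> S" and adj: "adj S = S"
    and pos: "\<And>x y. (x, y) \<in> S \<Longrightarrow> cinner y x \<in> \<real>\<^sub>\<ge>\<^sub>0"
    using S unfolding positive_selfadjoint_def linear_op_def by blast+
  have "\<exists>y. (x, y) \<in> S \<and> (y, a x) \<in> S" for x
    using SS mem_op_graph[of x "a x" a] by (metis relcompE prod.inject)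
  then obtain f where f: "\<And>x. (x, f x) \<in> S" "\<And>x. (f x, a x) \<in> S" by metis
  have S_iff: "(x, y) \<in> S \<longleftrightarrow> y = f x" for x y
    using f(1) sv by (meson single_valuedD)
  have sym: "cinner (f x) y = cinner x (f y)" for x y
  proof -
    have "(y, f y) \<in> adj S" using adj f(1) by simp
    then show ?thesis using f(1)[of x] by (auto simp: adj_def)
  qed
  have ff: "f (f x) = a x" for x using S_iff f(2) by metis
  have "bounded_linear f"
  proof (rule bounded_linear_intro)
    show "f (x + y) = f x + f y" for x y
      using lin(1)[OF f(1) f(1)] S_iff by metis
    show "f (r *\<^sub>R x) = r *\<^sub>R f x" for r x
      using lin(2)[OF f(1)] S_iff unfolding scaleR_scaleC by metis
    fix x
    have "(norm (f x))\<^sup>2 = inner (a x) x"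
      unfolding power2_norm_eq_inner using sym[of "f x" x]
      by (simp add: ff inner_eq_Re_cinner)
    also have "\<dots> \<le> norm (a x) * norm x" by (rule norm_cauchy_schwarz)
    also have "\<dots> \<le> (norm a * norm x) * norm x"
      by (intro mult_right_mono norm_blinfun) simp
    also have "\<dots> = (norm x * sqrt (norm a))\<^sup>2"
      by (simp add: power_mult_distrib power2_eq_square)
    finally show "norm (f x) \<le> norm x * sqrt (norm a)"
      by (rule power2_le_imp_le) simp
  qed
  then have f_app: "blinfun_apply (Blinfun f) = f" by (rule bounded_linear_Blinfun_apply)
  show thesis
  proof
    show "S = op_graph (Blinfun f)" using S_iff by (auto simp: f_app)
    show "0 \<le> inner (Blinfun f x) x" for x
      using pos[OF f(1)[of x]] by (simp add: f_app inner_eq_Re_cinner complex_nonneg_Reals_iff)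
    show "Blinfun f (Blinfun f x) = a x" for x by (simp add: f_app ff)
  qed
qed

lemma op_sqrt_op_graph:
  fixes a c :: "'a::chilbert_space \<Rightarrow>\<^sub>L 'a"
  assumes a: "adjoint_pair a a" "pos_definite a"
    and c: "adjoint_pair c c" "pos_definite c" "complex_linear c" "\<And>x. c (c x) = a x"
  shows "op_sqrt (op_graph a) = op_graph c"
  unfolding op_sqrt_def
proof (rule the_equality)
  show "positive_selfadjoint (op_graph c) \<and> op_graph c \<odot>\<^sub>o op_graph c = op_graph a"
    using positive_selfadjoint_op_graph[OF c(1,3)] pos_definite_nonneg[OF c(2)]
    by (simp add: op_graph_comp c(4))
  fix S assume S: "positive_selfadjoint S \<and> S \<odot>\<^sub>o S = op_graph a"
  then obtain s :: "'a \<Rightarrow>\<^sub>L 'a"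
    where s: "S = op_graph s" "\<And>x. 0 \<le> inner (s x) x" "\<And>x. s (s x) = a x"
    using positive_selfadjoint_root_bounded[of S a] by blast
  have "s = c"
    by (rule pos_definite_sqrt_unique[OF a s(2,3) pos_definite_nonneg[OF c(2)] c(4)])
  with s(1) show "S = op_graph c" by simp
qed

lemma defect_roots_op_sqrt:
  assumes t: "defect_roots t t' c d"
  shows "op_sqrt (Id \<oplus>\<^sub>o op_graph t \<odot>\<^sub>o op_graph t') = op_graph c"
    and "op_sqrt (Id \<oplus>\<^sub>o op_graph t' \<odot>\<^sub>o op_graph t) = op_graph d"
proof -
  have app: "blinfun_apply (id_blinfun + (u o\<^sub>L v)) = (\<lambda>x. x + u (v x))"
    for u :: "'y::chilbert_space \<Rightarrow>\<^sub>L 'x::chilbert_space" and v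
    by (simp add: fun_eq_iff blinfun.add_left)
  show "op_sqrt (Id \<oplus>\<^sub>o op_graph t \<odot>\<^sub>o op_graph t') = op_graph c"
    unfolding op_graph_comp Id_eq_op_graph op_graph_plus app[symmetric]
    using defect_positive[of t' t] defect_rootsD[OF t]
    by (intro op_sqrt_op_graph) (auto simp: adjoint_pair_sym blinfun.add_left)
  show "op_sqrt (Id \<oplus>\<^sub>o op_graph t' \<odot>\<^sub>o op_graph t) = op_graph d"
    unfolding op_graph_comp Id_eq_op_graph op_graph_plus app[symmetric]
    using defect_positive[of t t'] defect_rootsD[OF t]
    by (intro op_sqrt_op_graph) (auto simp: blinfun.add_left)
qed

section \<open>The distance in terms of bounded operators\<close>

text \<open>
  With \<open>c1\<close>, \<open>d1\<close> the roots belonging to \<open>T = t1\<close> and \<open>c2\<close>, \<open>d2\<close> those belonging to \<open>S = t2\<close>,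
  \<open>L_map d1 t1' t2' c2\<close> is \<open>L_T(S)\<close> and \<open>R_map c1 t1 c2 t2'\<close> is \<open>R_S(T)\<close>. They form the first column
  of \<open>g_T\<inverse> g_S\<close>, where \<open>g_T = ((c1, t1), (t1', d1))\<close> preserves the indefinite form of \<open>K \<oplus> H\<close>.
\<close>
definition L_map where "L_map d t' s' c = (d o\<^sub>L s') - (t' o\<^sub>L c)"
definition R_map where "R_map c t e s' = (c o\<^sub>L e) - (t o\<^sub>L s')"

lemma L_map_apply: "L_map d t' s' c x = d (s' x) - t' (c x)"
  by (simp add: L_map_def blinfun.diff_left)

lemma R_map_apply: "R_map c t e s' x = c (e x) - t (s' x)"
  by (simp add: R_map_def blinfun.diff_left)

lemma Sup_norm_quotient:
  fixes L :: "'a::real_normed_vector \<Rightarrow>\<^sub>L 'b::real_normed_vector"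
    and R :: "'a \<Rightarrow>\<^sub>L 'c::real_normed_vector"
  assumes LR: "\<And>x. (norm (R x))\<^sup>2 = (norm x)\<^sup>2 + (norm (L x))\<^sup>2"
  shows "Sup {norm (L x) | x. norm (R x) \<le> 1} = norm L / sqrt (1 + (norm L)\<^sup>2)"
proof (rule cSup_eq_non_empty)
  let ?l = "norm L"
  have pos: "0 < 1 + ?l\<^sup>2" by (simp add: add_pos_nonneg)
  show "{norm (L x) | x. norm (R x) \<le> 1} \<noteq> {}"
    by (auto intro!: exI[of _ 0] simp: blinfun.zero_right)
  fix y assume "y \<in> {norm (L x) | x. norm (R x) \<le> 1}"
  then obtain x where x: "y = norm (L x)" "norm (R x) \<le> 1" by blast
  have "(norm (L x))\<^sup>2 \<le> (?l * norm x)\<^sup>2"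
    by (intro power_mono norm_blinfun) simp
  then have "(norm (L x))\<^sup>2 * (1 + ?l\<^sup>2) \<le> ?l\<^sup>2 * (norm (R x))\<^sup>2"
    unfolding LR by (simp add: power_mult_distrib algebra_simps)
  also have "\<dots> \<le> ?l\<^sup>2 * 1"
    using x(2) by (intro mult_left_mono) (auto simp: power_le_one)
  finally have "(norm (L x))\<^sup>2 \<le> (?l / sqrt (1 + ?l\<^sup>2))\<^sup>2"
    using pos by (simp add: power_divide pos_le_divide_eq)
  then show "y \<le> ?l / sqrt (1 + ?l\<^sup>2)"
    unfolding x(1) by (rule power2_le_imp_le) simp
next
  let ?l = "norm L"
  have pos: "0 < 1 + ?l\<^sup>2" by (simp add: add_pos_nonneg)
  fix u assume u: "\<And>y. y \<in> {norm (L x) | x. norm (R x) \<le> 1} \<Longrightarrow> y \<le> u"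
  have u0: "0 \<le> u"
    by (rule u) (auto intro!: exI[of _ 0] simp: blinfun.zero_right)
  have Lu: "norm (L x) \<le> u * norm (R x)" for x
  proof (cases "R x = 0")
    case True
    then have "(norm x)\<^sup>2 + (norm (L x))\<^sup>2 = 0" using LR[of x] by simp
    then have "norm (L x) = 0" by (simp add: add_nonneg_eq_0_iff)
    then show ?thesis using u0 by simp
  next
    case False
    have "norm (L (inverse (norm (R x)) *\<^sub>R x)) \<le> u"
      using False by (intro u) (auto simp: blinfun.scaleR_right intro!: exI[of _ "inverse (norm (R x)) *\<^sub>R x"])
    then show ?thesis using False by (simp add: blinfun.scaleR_right field_simps)
  qed
  show "?l / sqrt (1 + ?l\<^sup>2) \<le> u"
  proof (cases "u < 1")
    case False
    have "?l\<^sup>2 \<le> (sqrt (1 + ?l\<^sup>2))\<^sup>2" using pos by simp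
    then have "?l \<le> sqrt (1 + ?l\<^sup>2)" by (rule power2_le_imp_le) simp
    then have "?l / sqrt (1 + ?l\<^sup>2) \<le> 1" using pos by (simp add: divide_le_eq_1)
    with False show ?thesis by linarith
  next
    case True
    then have u1: "0 < 1 - u\<^sup>2"
      using u0 by (simp add: power_less_one_iff)
    have "?l \<le> u / sqrt (1 - u\<^sup>2)"
    proof (rule norm_blinfun_bound)
      show "0 \<le> u / sqrt (1 - u\<^sup>2)" using u0 u1 by simp
      fix x
      have "(norm (L x))\<^sup>2 \<le> (u * norm (R x))\<^sup>2"
        by (intro power_mono Lu) simp
      then have "(norm (L x))\<^sup>2 * (1 - u\<^sup>2) \<le> u\<^sup>2 * (norm x)\<^sup>2"
        unfolding power_mult_distrib LR by (simp add: algebra_simps)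
      then have "(norm (L x))\<^sup>2 \<le> (u / sqrt (1 - u\<^sup>2) * norm x)\<^sup>2"
        using u1 by (simp add: power_mult_distrib power_divide pos_le_divide_eq)
      then show "norm (L x) \<le> u / sqrt (1 - u\<^sup>2) * norm x"
        by (rule power2_le_imp_le) (use u0 u1 in simp)
    qed
    then have "?l\<^sup>2 \<le> (u / sqrt (1 - u\<^sup>2))\<^sup>2" by (intro power_mono) auto
    then have "?l\<^sup>2 * (1 - u\<^sup>2) \<le> u\<^sup>2"
      using u1 by (simp add: power_divide pos_le_divide_eq)
    then have "(?l / sqrt (1 + ?l\<^sup>2))\<^sup>2 \<le> u\<^sup>2"
      using pos by (simp add: power_divide pos_divide_le_eq algebra_simps)
    then show ?thesis by (rule power2_le_imp_le) (rule u0)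
  qed
qed

lemma adjoint_pair_R_map:
  assumes 1: "defect_roots t1 t1' c1 d1" and 2: "defect_roots t2 t2' c2 d2"
  shows "adjoint_pair (R_map c1 t1 c2 t2') (R_map c2 t2 c1 t1')"
  unfolding adjoint_pair_def
  by (simp add: R_map_apply inner_diff_left inner_diff_right
      adjoint_pairD[OF defect_rootsD(4)[OF 1]] adjoint_pairD[OF defect_rootsD(4)[OF 2]]
      adjoint_pairD[OF defect_rootsD(1)[OF 1]] adjoint_pairD'[OF defect_rootsD(1)[OF 2]])

lemma R_map_decompose:
  assumes 1: "defect_roots t1 t1' c1 d1" and 2: "defect_roots t2 t2' c2 d2"
    and 3: "defect_roots t3 t3' c3 d3"
  shows "R_map c1 t1 c2 t2' x =
    R_map c1 t1 c3 t3' (R_map c3 t3 c2 t2' x)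
      - (t1 (d3 (L_map d3 t3' t2' c2 x)) - c1 (t3 (L_map d3 t3' t2' c2 x)))"
  by (simp add: R_map_apply L_map_apply blinfun.bilinear_simps defect_rootsD[OF 1]
      defect_rootsD[OF 2] defect_rootsD[OF 3])

lemma adjoint_pair_L_map:
  assumes 1: "defect_roots t1 t1' c1 d1" and 2: "defect_roots t2 t2' c2 d2"
  shows "inner (L_map d1 t1' t2' c2 x) y = inner x (t2 (d1 y) - c2 (t1 y))"
  by (simp add: L_map_apply inner_diff_left inner_diff_right
      adjoint_pairD[OF defect_rootsD(4)[OF 2]] adjoint_pairD[OF defect_rootsD(8)[OF 1]]
      adjoint_pairD'[OF defect_rootsD(1)[OF 1]] adjoint_pairD'[OF defect_rootsD(1)[OF 2]])

lemma R_map_self: "defect_roots t t' c d \<Longrightarrow> R_map c t c t' x = x"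
  by (simp add: R_map_apply defect_rootsD)

lemma norm_R_map:
  assumes 1: "defect_roots t1 t1' c1 d1" and 2: "defect_roots t2 t2' c2 d2"
  shows "(norm (R_map c1 t1 c2 t2' x))\<^sup>2 = (norm x)\<^sup>2 + (norm (L_map d1 t1' t2' c2 x))\<^sup>2"
proof -
  let ?R = "R_map c1 t1 c2 t2'" and ?L = "L_map d1 t1' t2' c2"
  have "R_map c2 t2 c1 t1' (?R x) = x + (t2 (d1 (?L x)) - c2 (t1 (?L x)))"
    using R_map_decompose[OF 2 2 1, of x] R_map_self[OF 2, of x] by (simp add: algebra_simps)
  then have "inner x (R_map c2 t2 c1 t1' (?R x)) = inner x x + inner (?L x) (?L x)"
    by (simp add: inner_add_right adjoint_pair_L_map[OF 1 2])
  then show ?thesis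
    by (simp add: adjoint_pairD[OF adjoint_pair_R_map[OF 1 2]] power2_norm_eq_inner)
qed

lemma op_dist_eq_arsinh:
  assumes 1: "defect_roots t1 t1' c1 d1" and 2: "defect_roots t2 t2' c2 d2"
  shows "op_dist (op_graph t1) (op_graph t2) = arsinh (norm (L_map d1 t1' t2' c2))"
proof -
  let ?R = "R_map c1 t1 c2 t2'" and ?L = "L_map d1 t1' t2' c2"
  have adj: "adj (op_graph t1) = op_graph t1'" "adj (op_graph t2) = op_graph t2'"
    using defect_rootsD[OF 1] defect_rootsD[OF 2] by (simp_all add: adj_op_graph)
  have "L_op (op_graph t1) (op_graph t2) = op_graph ?L"
    unfolding L_op_def adj defect_roots_op_sqrt[OF 1] defect_roots_op_sqrt[OF 2]
    by (simp add: op_graph_comp op_graph_minus fun_eq_iff L_map_apply)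
  moreover have "R_op (op_graph t2) (op_graph t1) = op_graph ?R"
    unfolding R_op_def adj defect_roots_op_sqrt[OF 1] defect_roots_op_sqrt[OF 2]
    by (simp add: op_graph_comp op_graph_minus fun_eq_iff R_map_apply)
  ultimately have "op_norm (L_op (op_graph t1) (op_graph t2) \<odot>\<^sub>o (R_op (op_graph t2) (op_graph t1))\<inverse>)
      = Sup {norm (?L x) | x. norm (?R x) \<le> 1}"
    unfolding op_norm_def by (intro arg_cong[where f = Sup]) (auto simp: relcomp_unfold)
  also have "\<dots> = norm ?L / sqrt (1 + (norm ?L)\<^sup>2)"
    by (rule Sup_norm_quotient) (rule norm_R_map[OF 1 2])
  also have "\<dots> = tanh (arsinh (norm ?L))"
    by (simp add: tanh_def cosh_arsinh_real add.commute)
  finally show ?thesis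
    using defect_rootsD(2)[OF 1] defect_rootsD(2)[OF 2]
    by (simp add: op_dist_def op_graph_closed_ops artanh_tanh_real)
qed

section \<open>Metric axioms\<close>

lemma op_dist_le_iff:
  assumes 1: "defect_roots t1 t1' c1 d1" and 2: "defect_roots t2 t2' c2 d2" and "0 \<le> r"
  shows "op_dist (op_graph t1) (op_graph t2) \<le> r \<longleftrightarrow>
    (\<forall>x. norm (R_map c1 t1 c2 t2' x) \<le> cosh r * norm x)"
proof -
  let ?R = "R_map c1 t1 c2 t2'" and ?L = "L_map d1 t1' t2' c2"
  have "norm (?L x) \<le> sinh r * norm x \<longleftrightarrow> norm (?R x) \<le> cosh r * norm x" for x
  proof -
    have "norm (?L x) \<le> sinh r * norm x \<longleftrightarrow> (norm (?L x))\<^sup>2 \<le> (sinh r * norm x)\<^sup>2"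
      using \<open>0 \<le> r\<close> by (simp add: power_mono_iff)
    also have "\<dots> \<longleftrightarrow> (norm (?R x))\<^sup>2 \<le> (cosh r * norm x)\<^sup>2"
      unfolding norm_R_map[OF 1 2] power_mult_distrib cosh_square_eq by (simp add: algebra_simps)
    also have "\<dots> \<longleftrightarrow> norm (?R x) \<le> cosh r * norm x"
      by (simp add: power_mono_iff)
    finally show ?thesis .
  qed
  moreover have "arsinh (norm ?L) \<le> r \<longleftrightarrow> norm ?L \<le> sinh r"
    by (metis sinh_arsinh_real sinh_real_le_iff)
  moreover have "norm ?L \<le> sinh r \<longleftrightarrow> (\<forall>x. norm (?L x) \<le> sinh r * norm x)"
  proof
    assume "norm ?L \<le> sinh r"
    then show "\<forall>x. norm (?L x) \<le> sinh r * norm x"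
      by (meson mult_right_mono norm_blinfun norm_ge_zero order_trans)
  qed (use \<open>0 \<le> r\<close> in \<open>simp add: norm_blinfun_bound\<close>)
  ultimately show ?thesis by (simp add: op_dist_eq_arsinh[OF 1 2])
qed

lemma op_dist_nonneg:
  assumes 1: "defect_roots t1 t1' c1 d1" and 2: "defect_roots t2 t2' c2 d2"
  shows "0 \<le> op_dist (op_graph t1) (op_graph t2)"
  unfolding op_dist_eq_arsinh[OF assms]
  by (metis arsinh_real_neg_iff norm_ge_zero not_le)

lemma norm_L_map_le:
  assumes 1: "defect_roots t1 t1' c1 d1" and 2: "defect_roots t2 t2' c2 d2"
  shows "norm (L_map d1 t1' t2' c2 x) \<le> sinh (op_dist (op_graph t1) (op_graph t2)) * norm x"
  by (simp add: op_dist_eq_arsinh[OF 1 2] norm_blinfun)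

lemma op_dist_commute:
  assumes 1: "defect_roots t1 t1' c1 d1" and 2: "defect_roots t2 t2' c2 d2"
  shows "op_dist (op_graph t1) (op_graph t2) = op_dist (op_graph t2) (op_graph t1)"
proof -
  have "op_dist (op_graph t2) (op_graph t1) \<le> op_dist (op_graph t1) (op_graph t2)"
    if 1: "defect_roots t1 t1' c1 d1" and 2: "defect_roots t2 t2' c2 d2"
    for t1 t2 :: "'a \<Rightarrow>\<^sub>L 'b" and t1' t2' c1 c2 d1 d2
    using op_dist_le_iff[OF 1 2 op_dist_nonneg[OF 1 2]] op_dist_le_iff[OF 2 1 op_dist_nonneg[OF 1 2]]
      adjoint_pair_bound[OF adjoint_pair_R_map[OF 1 2]] cosh_real_nonneg by blast
  from this[OF 1 2] this[OF 2 1] show ?thesis by simp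
qed

lemma op_dist_triangle:
  assumes 1: "defect_roots t1 t1' c1 d1" and 2: "defect_roots t2 t2' c2 d2"
    and 3: "defect_roots t3 t3' c3 d3"
  shows "op_dist (op_graph t1) (op_graph t2)
    \<le> op_dist (op_graph t1) (op_graph t3) + op_dist (op_graph t3) (op_graph t2)"
    (is "_ \<le> ?a + ?b")
proof -
  have a: "0 \<le> ?a" and b: "0 \<le> ?b" by (rule op_dist_nonneg[OF 1 3] op_dist_nonneg[OF 3 2])+
  have "norm (R_map c1 t1 c2 t2' x) \<le> cosh (?a + ?b) * norm x" for x
  proof -
    let ?y = "L_map d3 t3' t2' c2 x"
    have "adjoint_pair (L_map d3 t3' t1' c1) (\<lambda>y. t1 (d3 y) - c1 (t3 y))"
      using adjoint_pair_L_map[OF 3 1] by (simp add: adjoint_pair_def)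
    then have "norm (t1 (d3 ?y) - c1 (t3 ?y)) \<le> sinh ?a * norm ?y"
      by (rule adjoint_pair_bound)
        (use a norm_L_map_le[OF 3 1] in \<open>simp_all add: op_dist_commute[OF 1 3]\<close>)
    also have "\<dots> \<le> sinh ?a * (sinh ?b * norm x)"
      using a by (intro mult_left_mono norm_L_map_le[OF 3 2]) simp
    finally have y: "norm (t1 (d3 ?y) - c1 (t3 ?y)) \<le> sinh ?a * (sinh ?b * norm x)" .
    have "norm (R_map c1 t1 c3 t3' (R_map c3 t3 c2 t2' x)) \<le> cosh ?a * norm (R_map c3 t3 c2 t2' x)"
      using op_dist_le_iff[OF 1 3 a] by blast
    also have "\<dots> \<le> cosh ?a * (cosh ?b * norm x)"
      using op_dist_le_iff[OF 3 2 b] by (intro mult_left_mono) auto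
    finally show ?thesis
      unfolding R_map_decompose[OF 1 2 3, of x] cosh_add
      using norm_triangle_ineq4 y by (smt (verit) distrib_right mult.assoc)
  qed
  then show ?thesis using op_dist_le_iff[OF 1 2, of "?a + ?b"] a b by simp
qed

lemma R_L_map_recover:
  assumes "defect_roots t t' c d"
  shows "c (R_map c t e s' x) + t (L_map d t' s' e x) = e x"
    and "t' (R_map c t e s' x) + d (L_map d t' s' e x) = s' x"
  by (simp_all add: R_map_apply L_map_apply blinfun.bilinear_simps defect_rootsD[OF assms])

lemma op_dist_eq_0_iff:
  assumes 1: "defect_roots t1 t1' c1 d1" and 2: "defect_roots t2 t2' c2 d2"
  shows "op_dist (op_graph t1) (op_graph t2) = 0 \<longleftrightarrow> t1 = t2"
proof
  assume "t1 = t2"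
  have "t1' = t2'"
    using defect_rootsD(1)[OF 1] defect_rootsD(1)[OF 2] \<open>t1 = t2\<close>
    by (metis adjoint_pairD blinfun_eqI vector_eq_ldot)
  then have "c1 = c2"
    using defect_positive[of t1' t1] defect_rootsD[OF 1] defect_rootsD[OF 2] \<open>t1 = t2\<close>
    by (intro pos_definite_sqrt_unique[of "id_blinfun + (t1 o\<^sub>L t1')"])
      (auto simp: blinfun.add_left pos_definite_nonneg adjoint_pair_sym)
  then have "R_map c1 t1 c2 t2' x = x" for x
    using \<open>t1 = t2\<close> \<open>t1' = t2'\<close> R_map_self[OF 1] by simp
  then have "op_dist (op_graph t1) (op_graph t2) \<le> 0"
    by (simp add: op_dist_le_iff[OF 1 2])
  with op_dist_nonneg[OF 1 2] show "op_dist (op_graph t1) (op_graph t2) = 0" by simp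
next
  assume 0: "op_dist (op_graph t1) (op_graph t2) = 0"
  let ?R = "R_map c1 t1 c2 t2'" and ?R' = "R_map c2 t2 c1 t1'"
  have L: "L_map d1 t1' t2' c2 x = 0" "L_map d2 t2' t1' c1 x = 0" for x
    using 0 op_dist_commute[OF 1 2]
    by (simp_all add: op_dist_eq_arsinh[OF 1 2] op_dist_eq_arsinh[OF 2 1])
  have c2: "c2 x = c1 (?R x)" for x
    using R_L_map_recover(1)[OF 1, where e = c2 and s' = t2'] L(1) by (simp add: blinfun.zero_right)
  have t2': "t2' x = t1' (?R x)" for x
    using R_L_map_recover(2)[OF 1, where e = c2 and s' = t2'] L(1) by (simp add: blinfun.zero_right)
  have RR': "?R (?R' x) = x" for x
    using R_map_decompose[OF 1 1 2, of x] R_map_self[OF 1, of x]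
    by (simp add: L blinfun.zero_right)
  have "c2 x = ?R' (c1 x)" for x
  proof -
    have "inner (c2 x) y = inner (?R' (c1 x)) y" for y
      using c2[of y] by (simp add: adjoint_pairD[OF defect_rootsD(4)[OF 1]]
          adjoint_pairD[OF defect_rootsD(4)[OF 2]] adjoint_pairD[OF adjoint_pair_R_map[OF 2 1]])
    then show ?thesis by (metis vector_eq_rdot)
  qed
  then have "c2 (c2 x) = c1 (c1 x)" for x
    by (metis c2 RR')
  then have "c1 = c2"
    using defect_positive[of t1' t1] defect_rootsD[OF 1] defect_rootsD[OF 2]
    by (intro pos_definite_sqrt_unique[of "id_blinfun + (t1 o\<^sub>L t1')"])
      (auto simp: blinfun.add_left pos_definite_nonneg adjoint_pair_sym)
  have "?R x = x" for x
  proof -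
    have "c1 (?R x - x) = 0" using c2[of x] \<open>c1 = c2\<close> by (simp add: blinfun.diff_right)
    then have "?R x - x = 0" by (rule pos_definite_injective[OF defect_rootsD(5)[OF 1]])
    then show ?thesis by simp
  qed
  then have "t1' = t2'" by (simp add: blinfun_eqI t2')
  then show "t1 = t2"
    using defect_rootsD(1)[OF 1] defect_rootsD(1)[OF 2]
    by (metis adjoint_pairD blinfun_eqI vector_eq_rdot)
qed

section \<open>Closed operators into a finite-dimensional space\<close>

lemma closed_subspace_projection:
  fixes V :: "'a::{real_inner,banach} set"
  assumes V: "subspace V" "closed V"
  obtains v where "v \<in> V" "\<And>w. w \<in> V \<Longrightarrow> inner (x - v) w = 0"
proof -
  define D where "D = Inf ((\<lambda>v. (norm (x - v))\<^sup>2) ` V)"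
  have bdd: "bdd_below ((\<lambda>v. (norm (x - v))\<^sup>2) ` V)" by (intro bdd_belowI2[of _ 0]) simp
  have D: "D \<le> (norm (x - v))\<^sup>2" if "v \<in> V" for v
    unfolding D_def by (rule cINF_lower[OF bdd that])
  have "\<exists>v\<in>V. (norm (x - v))\<^sup>2 < D + 1 / (real n + 1)" for n
  proof -
    have "V \<noteq> {}" using subspace_0[OF V(1)] by blast
    then show ?thesis
      using cINF_less_iff[OF _ bdd, of "D + 1 / (real n + 1)"] by (simp add: D_def)
  qed
  then obtain f :: "nat \<Rightarrow> 'a" where f: "\<And>n. f n \<in> V" "\<And>n. (norm (x - f n))\<^sup>2 < D + 1 / (real n + 1)" by metis
  have dist: "(norm (f m - f n))\<^sup>2 \<le> 2 / (real m + 1) + 2 / (real n + 1)" for m n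
  proof -
    let ?h = "(1/2) *\<^sub>R (f m + f n)"
    have "?h \<in> V" using f(1) V(1) by (intro subspace_scale subspace_add)
    then have "D \<le> (norm (x - ?h))\<^sup>2" by (rule D)
    moreover have "(norm (f m - f n))\<^sup>2 =
        2 * (norm (x - f m))\<^sup>2 + 2 * (norm (x - f n))\<^sup>2 - 4 * (norm (x - ?h))\<^sup>2"
      unfolding power2_norm_eq_inner
      by (simp add: inner_simps inner_commute algebra_simps)
    moreover have "2 / (real m + 1) = 2 * (1 / (real m + 1))" "2 / (real n + 1) = 2 * (1 / (real n + 1))"
      by simp_all
    ultimately show ?thesis using f(2)[of m] f(2)[of n] by linarith
  qed
  have "Cauchy f"
  proof (rule metric_CauchyI)
    fix e :: real assume "0 < e"
    obtain N :: nat where N: "4 / e\<^sup>2 < real N" using reals_Archimedean2 by blast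
    have "dist (f m) (f n) < e" if "N \<le> m" "N \<le> n" for m n
    proof -
      have "0 < 4 / e\<^sup>2" using \<open>0 < e\<close> by simp
      then have "2 / (real m + 1) + 2 / (real n + 1) \<le> 2 / real N + 2 / real N"
        using less_trans[OF \<open>0 < 4 / e\<^sup>2\<close> N] that
        by (intro add_mono divide_left_mono mult_pos_pos) auto
      also have "\<dots> < e\<^sup>2"
        using N \<open>0 < e\<close> less_trans[OF \<open>0 < 4 / e\<^sup>2\<close> N] by (simp add: field_simps)
      finally have "(norm (f m - f n))\<^sup>2 < e\<^sup>2" using dist[of m n] by (simp add: add.commute)
      then show ?thesis using \<open>0 < e\<close> by (simp add: dist_norm power2_less_imp_less)
    qed
    then show "\<exists>M. \<forall>m\<ge>M. \<forall>n\<ge>M. dist (f m) (f n) < e" by blast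
  qed
  then obtain v where v: "f \<longlonglongrightarrow> v" using Cauchy_convergent convergent_def by blast
  have "v \<in> V" using closed_sequentially[OF V(2)] f(1) v by blast
  have lim: "(\<lambda>n. D + 1 / (real n + 1)) \<longlonglongrightarrow> D + 0"
    using LIMSEQ_inverse_real_of_nat by (intro tendsto_add tendsto_const) (simp add: inverse_eq_divide add.commute)
  have "(\<lambda>n. (norm (x - f n))\<^sup>2) \<longlonglongrightarrow> (norm (x - v))\<^sup>2"
    by (intro tendsto_intros v)
  then have vD: "(norm (x - v))\<^sup>2 \<le> D"
    using LIMSEQ_le[OF _ lim] f(2) by (simp add: less_imp_le add.commute)
  show thesis
  proof (rule that[OF \<open>v \<in> V\<close>])
    fix w assume "w \<in> V"
    show "inner (x - v) w = 0"
    proof (cases "w = 0")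
      case False
      then have ww: "inner w w > 0" by simp
      define s where "s = inner (x - v) w / inner w w"
      have "v + s *\<^sub>R w \<in> V" using V(1) \<open>v \<in> V\<close> \<open>w \<in> V\<close> by (intro subspace_scale subspace_add)
      then have "(norm (x - v))\<^sup>2 \<le> (norm (x - (v + s *\<^sub>R w)))\<^sup>2" by (rule order_trans[OF vD D])
      also have "\<dots> = (norm (x - v))\<^sup>2 - 2 * (s * inner (x - v) w) + s * (s * inner w w)"
        unfolding power2_norm_eq_inner by (simp add: inner_simps inner_commute algebra_simps)
      finally have "2 * (s * inner (x - v) w) \<le> s * (s * inner w w)" by simp
      also have "s * inner w w = inner (x - v) w" using ww by (simp add: s_def)
      finally have "s * inner (x - v) w \<le> 0" by simp
      then have "inner (x - v) w * inner (x - v) w \<le> 0"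
        using ww by (simp add: s_def field_simps)
      then show ?thesis by (auto simp: mult_le_0_iff)
    qed simp
  qed
qed

lemma cinner_sum_left: "cinner (\<Sum>i\<in>I. f i) y = (\<Sum>i\<in>I. cinner (f i) y)"
  by (induction I rule: infinite_finite_induct) (simp_all add: cinner_add_left)

lemma cinner_sum_right: "cinner y (\<Sum>i\<in>I. f i) = (\<Sum>i\<in>I. cinner y (f i))"
  by (induction I rule: infinite_finite_induct) (simp_all add: cinner_add_right)

lemma gram_schmidt_expansion:
  fixes S D :: "'a::complex_inner set"
  assumes "finite S" and D: "module.subspace scaleC D" and "S \<subseteq> D"
  obtains E where "finite E" "E \<subseteq> D" "\<And>e. e \<in> E \<Longrightarrow> cinner e e = 1"
    "\<And>e e'. e \<in> E \<Longrightarrow> e' \<in> E \<Longrightarrow> e \<noteq> e' \<Longrightarrow> cinner e e' = 0"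
    "\<And>b. b \<in> S \<Longrightarrow> (\<Sum>e\<in>E. cinner b e *\<^sub>C e) = b"
  using assms(1,3)
proof (induction S arbitrary: thesis rule: finite_induct)
  case empty
  show ?case by (rule empty.prems(1)[of "{}"]) auto
next
  interpret vector_space "scaleC :: complex \<Rightarrow> 'a \<Rightarrow> 'a" by (rule vector_space_scaleC)
  case (insert b S)
  obtain E where E: "finite E" "E \<subseteq> D" "\<And>e. e \<in> E \<Longrightarrow> cinner e e = 1"
    "\<And>e e'. e \<in> E \<Longrightarrow> e' \<in> E \<Longrightarrow> e \<noteq> e' \<Longrightarrow> cinner e e' = 0"
    "\<And>b. b \<in> S \<Longrightarrow> (\<Sum>e\<in>E. cinner b e *\<^sub>C e) = b"
    using insert.IH insert.prems(2) by blast
  define r where "r = b - (\<Sum>e\<in>E. cinner b e *\<^sub>C e)"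
  have r: "cinner r e' = 0" if "e' \<in> E" for e'
  proof -
    have "(\<Sum>e\<in>E. cinner b e * cinner e e') = (\<Sum>e\<in>E. if e = e' then cinner b e' else 0)"
      using E(3,4) that by (intro sum.cong) auto
    then show ?thesis
      using that E(1) by (simp add: r_def cinner_diff_left cinner_sum_left cinner_scaleC_left)
  qed
  have rD: "r \<in> D"
    using D E(2) insert.prems(2) unfolding r_def by (intro subspace_diff subspace_sum subspace_scale) auto
  show ?case
  proof (cases "r = 0")
    case True
    with E show ?thesis by (intro insert.prems(1)[of E]) (auto simp: r_def)
  next
    case False
    define e0 where "e0 = complex_of_real (1 / norm r) *\<^sub>C r"
    have "norm e0 = 1" using False by (simp add: e0_def norm_scaleC norm_divide)
    then have e0: "cinner e0 e0 = 1" by (simp add: cinner_self)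
    have e0E: "cinner e0 e = 0" "cinner e e0 = 0" if "e \<in> E" for e
    proof -
      show "cinner e0 e = 0" using r[OF that] by (simp add: e0_def cinner_scaleC_left)
      then show "cinner e e0 = 0" by (metis cinner_commute complex_cnj_zero)
    qed
    then have "e0 \<notin> E" using e0 by force
    have E_e0: "cinner (\<Sum>e\<in>E. f e *\<^sub>C e) e0 = 0" for f
      using e0E by (simp add: cinner_sum_left cinner_scaleC_left)
    have r_e0: "cinner r e0 *\<^sub>C e0 = r"
      using False by (simp add: e0_def cinner_scaleC_right cinner_self scaleC_scaleC power2_eq_square scaleC_one)
    show ?thesis
    proof (rule insert.prems(1)[of "insert e0 E"])
      show "insert e0 E \<subseteq> D" using D E(2) rD by (auto simp: e0_def intro: subspace_scale)
      fix c assume "c \<in> insert b S"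
      show "(\<Sum>e\<in>insert e0 E. cinner c e *\<^sub>C e) = c"
      proof (cases "c = b")
        case True
        have "b = r + (\<Sum>e\<in>E. cinner b e *\<^sub>C e)" by (simp add: r_def)
        moreover from this have "cinner b e0 = cinner r e0"
          using E_e0 by (metis add.right_neutral cinner_add_left)
        ultimately show ?thesis
          using \<open>e0 \<notin> E\<close> E(1) r_e0 True by simp
      next
        case False
        then have c: "(\<Sum>e\<in>E. cinner c e *\<^sub>C e) = c" using \<open>c \<in> insert b S\<close> E(5) by blast
        then have "cinner c e0 = 0" using E_e0 by metis
        then show ?thesis using \<open>e0 \<notin> E\<close> E(1) c by simp
      qed
    qed (use E e0 e0E in auto)
  qed
qed

lemma fin_dim_dense_subspace_basis:
  fixes D :: "'k::complex_inner set"
  assumes fd: "finite_dimensional_vector_space (scaleC :: complex \<Rightarrow> 'k \<Rightarrow> 'k) B"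
    and D: "module.subspace scaleC D" and orth: "\<And>y. (\<And>x. x \<in> D \<Longrightarrow> cinner x y = 0) \<Longrightarrow> y = 0"
  obtains E where "finite E" "E \<subseteq> D" "\<And>y. (\<Sum>e\<in>E. cinner y e *\<^sub>C e) = y"
proof -
  interpret finite_dimensional_vector_space "scaleC :: complex \<Rightarrow> 'k \<Rightarrow> 'k" B by (rule fd)
  obtain S where S: "finite S" "S \<subseteq> D" "span S = D"
    using basis_subspace_exists[OF D] by metis
  obtain E where E: "finite E" "E \<subseteq> D" "\<And>e. e \<in> E \<Longrightarrow> cinner e e = 1"
    "\<And>e e'. e \<in> E \<Longrightarrow> e' \<in> E \<Longrightarrow> e \<noteq> e' \<Longrightarrow> cinner e e' = 0"
    "\<And>b. b \<in> S \<Longrightarrow> (\<Sum>e\<in>E. cinner b e *\<^sub>C e) = b"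
    using gram_schmidt_expansion[OF S(1) D S(2)] by metis
  have "subspace {y. (\<Sum>e\<in>E. cinner y e *\<^sub>C e) = y}"
  proof (rule subspaceI)
    show "0 \<in> {y. (\<Sum>e\<in>E. cinner y e *\<^sub>C e) = y}" by simp
    show "x + y \<in> {y. (\<Sum>e\<in>E. cinner y e *\<^sub>C e) = y}"
      if "x \<in> {y. (\<Sum>e\<in>E. cinner y e *\<^sub>C e) = y}" "y \<in> {y. (\<Sum>e\<in>E. cinner y e *\<^sub>C e) = y}" for x y
      using that by (simp add: cinner_add_left scaleC_add_left sum.distrib)
    show "c *\<^sub>C x \<in> {y. (\<Sum>e\<in>E. cinner y e *\<^sub>C e) = y}"
      if "x \<in> {y. (\<Sum>e\<in>E. cinner y e *\<^sub>C e) = y}" for c x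
    proof -
      have "(\<Sum>e\<in>E. cinner (c *\<^sub>C x) e *\<^sub>C e) = c *\<^sub>C (\<Sum>e\<in>E. cinner x e *\<^sub>C e)"
        unfolding scale_sum_right by (simp add: cinner_scaleC_left)
      with that show ?thesis by simp
    qed
  qed
  then have DE: "(\<Sum>e\<in>E. cinner y e *\<^sub>C e) = y" if "y \<in> D" for y
    using span_minimal[of S "{y. (\<Sum>e\<in>E. cinner y e *\<^sub>C e) = y}"] E(5) S(3) that by blast
  have "(\<Sum>e\<in>E. cinner y e *\<^sub>C e) = y" for y
  proof -
    define r where "r = y - (\<Sum>e\<in>E. cinner y e *\<^sub>C e)"
    have "cinner r e' = 0" if "e' \<in> E" for e'
    proof -
      have "(\<Sum>e\<in>E. cinner y e * cinner e e') = (\<Sum>e\<in>E. if e = e' then cinner y e' else 0)"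
        using E(3,4) that by (intro sum.cong) auto
      then show ?thesis
        using that E(1) by (simp add: r_def cinner_diff_left cinner_sum_left cinner_scaleC_left)
    qed
    then have "cinner e r = 0" if "e \<in> E" for e
      using that by (metis cinner_commute complex_cnj_zero)
    then have "cinner (\<Sum>e\<in>E. cinner x e *\<^sub>C e) r = 0" for x
      by (simp add: cinner_sum_left cinner_scaleC_left)
    then have "r = 0" using orth DE by metis
    then show ?thesis by (simp add: r_def)
  qed
  with E(1,2) show thesis by (rule that)
qed

lemma bounded_linear_cinner_scaleC:
  "bounded_linear (\<lambda>x. cinner x a *\<^sub>C b)" for a :: "'a::complex_inner" and b :: "'b::complex_inner"
proof (rule bounded_linear_intro)
  show "norm (cinner x a *\<^sub>C b) \<le> norm x * (norm a * norm b)" for x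
    using mult_right_mono[OF norm_cinner_le[of x a], of "norm b"] by (simp add: norm_scaleC mult.assoc)
  show "cinner (r *\<^sub>R x) a *\<^sub>C b = r *\<^sub>R (cinner x a *\<^sub>C b)" for r x
    by (simp add: scaleR_scaleC cinner_scaleC_left scaleC_scaleC)
qed (simp add: cinner_add_left scaleC_add_left)

lemma mem_adj_iff: "(y, z) \<in> adj A \<longleftrightarrow> (\<forall>x w. (x, w) \<in> A \<longrightarrow> cinner w y = cinner x z)"
  by (auto simp: adj_def)

lemma orthogonal_adj_domain_eq_0:
  fixes T :: "('h::chilbert_space \<times> 'k::chilbert_space) set"
  assumes T: "linear_op T" "closed T" and y: "\<And>x. x \<in> Domain (adj T) \<Longrightarrow> cinner x y = 0"
  shows "y = 0"
proof -
  have sv: "single_valued T" and T0: "(0, 0) \<in> T"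
    and add: "\<And>x y x' y'. (x, y) \<in> T \<Longrightarrow> (x', y') \<in> T \<Longrightarrow> (x + x', y + y') \<in> T"
    and scale: "\<And>c x y. (x, y) \<in> T \<Longrightarrow> (c *\<^sub>C x, c *\<^sub>C y) \<in> T"
    using T(1) unfolding linear_op_def by blast+
  have "subspace T"
    using T0 add scale by (auto simp: subspace_def zero_prod_def scaleR_scaleC)
  then obtain v where v: "v \<in> T" "\<And>w. w \<in> T \<Longrightarrow> inner ((0, y) - v) w = 0"
    using closed_subspace_projection[OF _ T(2), of "(0, y)"] by metis
  obtain h k where hk: "(0, y) - v = (h, k)" by fastforce
  have re: "inner x h + inner w k = 0" if "(x, w) \<in> T" for x w
    using v(2)[OF that] hk by (simp add: inner_commute)
  have "cinner w k = cinner x (- h)" if "(x, w) \<in> T" for x w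
  proof -
    have minus: "cinner x (- h) = - cinner x h"
      using cinner_diff_right[of x 0 h] by simp
    have "Re (cinner w k) = Re (cinner x (- h))"
      using re[OF that] by (simp add: minus inner_eq_Re_cinner)
    moreover have "Im (cinner w k) = Im (cinner x (- h))"
      using re[OF scale[OF that, of "\<i>"]]
      by (simp add: minus inner_eq_Re_cinner cinner_scaleC_left)
    ultimately show ?thesis by (rule complex_eqI)
  qed
  then have "(k, - h) \<in> adj T" by (auto simp: mem_adj_iff)
  then have "cinner k y = 0" using y by blast
  then have "inner (h, k) (0, y) = 0" by (simp add: inner_eq_Re_cinner)
  moreover have "inner (h, k) v = 0" using v hk by metis
  ultimately have "inner (h, k) (h, k) = 0"
    using hk by (metis inner_diff_right diff_zero)
  then have "(0, y) = v" using hk by (metis eq_iff_diff_eq_0 inner_eq_zero_iff)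
  then show "y = 0" using v(1) T0 sv by (metis single_valuedD)
qed

lemma closed_ops_bounded:
  fixes T :: "('h::chilbert_space \<times> 'k::chilbert_space) set" and B :: "'k set"
  assumes fd: "finite_dimensional_vector_space (scaleC :: complex \<Rightarrow> 'k \<Rightarrow> 'k) B"
    and T: "T \<in> closed_ops"
  obtains t :: "'h \<Rightarrow>\<^sub>L 'k" and t' :: "'k \<Rightarrow>\<^sub>L 'h"
  where "adjoint_pair t t'" "complex_linear t" "complex_linear t'" "T = op_graph t"
proof -
  interpret finite_dimensional_vector_space "scaleC :: complex \<Rightarrow> 'k \<Rightarrow> 'k" B by (rule fd)
  have lin: "linear_op T" and cl: "closed T" and dense: "closure (Domain T) = UNIV"
    using T by (auto simp: closed_ops_def densely_defined_def)
  have "subspace (Domain (adj T))"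
    unfolding subspace_def
  proof (intro conjI allI ballI)
    show "0 \<in> Domain (adj T)" by (rule DomainI[of 0 0]) (simp add: mem_adj_iff)
    show "x + y \<in> Domain (adj T)" if xy: "x \<in> Domain (adj T)" "y \<in> Domain (adj T)" for x y
    proof -
      obtain u v where "(x, u) \<in> adj T" "(y, v) \<in> adj T" using xy by blast
      then have "(x + y, u + v) \<in> adj T" by (auto simp: mem_adj_iff cinner_add_right)
      then show ?thesis by blast
    qed
    show "c *\<^sub>C x \<in> Domain (adj T)" if x: "x \<in> Domain (adj T)" for c x
    proof -
      obtain u where "(x, u) \<in> adj T" using x by blast
      then have "(c *\<^sub>C x, c *\<^sub>C u) \<in> adj T" by (auto simp: mem_adj_iff cinner_scaleC_right)
      then show ?thesis by blast
    qed
  qed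
  then obtain E where E: "finite E" "E \<subseteq> Domain (adj T)" "\<And>y. (\<Sum>e\<in>E. cinner y e *\<^sub>C e) = y"
    using fin_dim_dense_subspace_basis[OF fd _ orthogonal_adj_domain_eq_0[OF lin cl]] by blast
  have "\<forall>e\<in>E. \<exists>z. (e, z) \<in> adj T" using E(2) by blast
  from bchoice[OF this] obtain g where g: "\<And>e. e \<in> E \<Longrightarrow> (e, g e) \<in> adj T" by blast
  define t where "t = Blinfun (\<lambda>x. \<Sum>e\<in>E. cinner x (g e) *\<^sub>C e)"
  define t' where "t' = Blinfun (\<lambda>y. \<Sum>e\<in>E. cinner y e *\<^sub>C g e)"
  have t: "t x = (\<Sum>e\<in>E. cinner x (g e) *\<^sub>C e)" for x
    unfolding t_def by (subst bounded_linear_Blinfun_apply)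
      (intro bounded_linear_sum bounded_linear_cinner_scaleC, simp)
  have t': "t' y = (\<Sum>e\<in>E. cinner y e *\<^sub>C g e)" for y
    unfolding t'_def by (subst bounded_linear_Blinfun_apply)
      (intro bounded_linear_sum bounded_linear_cinner_scaleC, simp)
  have scale_sum: "c *\<^sub>C (\<Sum>e\<in>E. f e) = (\<Sum>e\<in>E. c *\<^sub>C f e)" for c and f :: "'k \<Rightarrow> 'z::complex_inner"
  proof -
    interpret Z: vector_space "scaleC :: complex \<Rightarrow> 'z \<Rightarrow> 'z" by (rule vector_space_scaleC)
    show ?thesis by (rule Z.scale_sum_right)
  qed
  have sub: "w = t x" if "(x, w) \<in> T" for x w
  proof -
    have "cinner w e = cinner x (g e)" if "e \<in> E" for e
      using g[OF that] \<open>(x, w) \<in> T\<close> by (auto simp: mem_adj_iff)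
    then show ?thesis using E(3)[of w] by (simp add: t)
  qed
  show thesis
  proof
    show "complex_linear t" "complex_linear t'"
      by (simp_all add: complex_linear_def t t' cinner_scaleC_left scale_sum scaleC_scaleC)
    show "adjoint_pair t t'"
      unfolding adjoint_pair_def inner_eq_Re_cinner t t'
      by (simp add: cinner_sum_left cinner_sum_right cinner_scaleC_left cinner_scaleC_right
          mult.commute flip: cinner_commute)
    have "(x, t x) \<in> T" for x
    proof -
      obtain f where f: "\<And>n. f n \<in> Domain T" "f \<longlonglongrightarrow> x"
        using dense closure_sequential by (metis UNIV_I)
      have "(f n, t (f n)) \<in> T" for n using f(1)[of n] sub by blast
      moreover have "(\<lambda>n. (f n, t (f n))) \<longlonglongrightarrow> (x, t x)"
        by (intro tendsto_intros f(2))
      ultimately show ?thesis by (rule closed_sequentially[OF cl])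
    qed
    then show "T = op_graph t" using sub by auto
  qed
qed

lemma fin_dim_inverse:
  fixes f f' :: "'k::chilbert_space \<Rightarrow>\<^sub>L 'k"
  assumes fd: "finite_dimensional_vector_space (scaleC :: complex \<Rightarrow> 'k \<Rightarrow> 'k) B"
    and ff': "adjoint_pair f f'" "complex_linear f" "complex_linear f'"
    and e: "e > 0" "\<And>x. e * norm x \<le> norm (f x)"
  obtains g g' :: "'k \<Rightarrow>\<^sub>L 'k" where "adjoint_pair g g'" "complex_linear g" "complex_linear g'"
    "\<And>x. f (g x) = x" "\<And>x. g (f x) = x" "\<And>x. f' (g' x) = x" "\<And>x. g' (f' x) = x"
proof -
  interpret finite_dimensional_vector_space "scaleC :: complex \<Rightarrow> 'k \<Rightarrow> 'k" B by (rule fd)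
  have linI: "Vector_Spaces.linear scaleC scaleC h" if "complex_linear h" for h :: "'k \<Rightarrow>\<^sub>L 'k"
    using that vector_space_scaleC by (auto simp: Vector_Spaces.linear_iff blinfun.add_right complex_linear_def)
  have f0: "x = 0" if "f x = 0" for x
    using e(2)[of x] e(1) that by (simp add: mult_le_0_iff)
  have "inj f"
    by (rule injI) (metis blinfun.diff_right eq_iff_diff_eq_0 f0)
  then have surj: "surj f"
    using linear_inj_imp_surj[OF linI[OF ff'(2)]] by blast
  have f'0: "y = 0" if "f' y = 0" for y
  proof -
    have "inner (f x) y = 0" for x using adjoint_pairD[OF ff'(1)] that by simp
    then show ?thesis using surj by (metis inner_eq_zero_iff surjD)
  qed
  have "inj f'"
    by (rule injI) (metis blinfun.diff_right eq_iff_diff_eq_0 f'0)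
  then have surj': "surj f'"
    using linear_inj_imp_surj[OF linI[OF ff'(3)]] by blast
  define g where "g = inv f"
  define g' where "g' = inv f'"
  have g: "f (g x) = x" "g (f x) = x" for x
    using surj \<open>inj f\<close> by (simp_all add: g_def surj_f_inv_f inv_f_f)
  have g': "f' (g' x) = x" "g' (f' x) = x" for x
    using surj' \<open>inj f'\<close> by (simp_all add: g'_def surj_f_inv_f inv_f_f)
  have adj: "adjoint_pair g g'"
    unfolding adjoint_pair_def by (metis adjoint_pairD[OF ff'(1)] g(1) g'(1))
  have bnd: "norm (g x) \<le> (1 / e) * norm x" for x
    using e(2)[of "g x"] e(1) by (simp add: g field_simps)
  have bnd': "norm (g' x) \<le> (1 / e) * norm x" for x
    by (rule adjoint_pair_bound[OF adj bnd]) (use e in simp)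
  have bl: "bounded_linear g"
    by (rule bounded_linear_intro[where K = "1 / e"])
      (metis blinfun.add_right g, metis blinfun.scaleR_right g, use bnd in \<open>simp add: mult.commute\<close>)
  have bl': "bounded_linear g'"
    by (rule bounded_linear_intro[where K = "1 / e"])
      (metis blinfun.add_right g', metis blinfun.scaleR_right g', use bnd' in \<open>simp add: mult.commute\<close>)
  have "complex_linear g" "complex_linear g'"
    unfolding complex_linear_def by (metis complex_linearD[OF ff'(2)] g, metis complex_linearD[OF ff'(3)] g')
  then show thesis
    using that[of "Blinfun g" "Blinfun g'"] adj g g'
    by (simp add: bounded_linear_Blinfun_apply[OF bl] bounded_linear_Blinfun_apply[OF bl'])
qed

section \<open>Midpoints\<close>

lemma pos_definite_fin_dim_inverse:
  fixes f :: "'k::chilbert_space \<Rightarrow>\<^sub>L 'k"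
  assumes fd: "finite_dimensional_vector_space (scaleC :: complex \<Rightarrow> 'k \<Rightarrow> 'k) B"
    and f: "adjoint_pair f f" "complex_linear f" "pos_definite f"
  obtains g :: "'k \<Rightarrow>\<^sub>L 'k" where "adjoint_pair g g" "complex_linear g" "\<And>x. f (g x) = x" "\<And>x. g (f x) = x"
proof -
  obtain e where e: "e > 0" "\<And>x. e * inner x x \<le> inner (f x) x"
    using f(3) unfolding pos_definite_def by blast
  have "e * norm x \<le> norm (f x)" for x
  proof (cases "x = 0")
    case False
    have "e * inner x x \<le> norm (f x) * norm x"
      using e(2)[of x] norm_cauchy_schwarz order_trans by blast
    then have "(e * norm x) * norm x \<le> norm (f x) * norm x"
      by (simp add: power2_eq_square mult.assoc flip: power2_norm_eq_inner)
    with False show ?thesis by simp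
  qed simp
  then obtain g g' :: "'k \<Rightarrow>\<^sub>L 'k" where g: "adjoint_pair g g'" "complex_linear g"
    "\<And>x. f (g x) = x" "\<And>x. g (f x) = x" "\<And>x. f (g' x) = x"
    using fin_dim_inverse[OF fd f(1,2,2) e(1)] by metis
  have "g' x = g x" for x using g(4)[of "g' x"] g(5)[of x] by simp
  then have "adjoint_pair g g" using g(1) by (simp add: adjoint_pair_def)
  with g show thesis by (intro that) auto
qed

text \<open>
  Any two operators \<open>Z1\<close>, \<open>Z2\<close> with \<open>Z1* Z1 - Z2* Z2 = N\<close> positive definite parametrise the graph
  of a strict contraction, hence an operator \<open>v\<close>: put \<open>v* = Z2 X\<close> with \<open>X = Z1\<inverse> c\<close> and
  \<open>c = (Z1 N\<inverse> Z1*)\<^sup>1\<^sup>/\<^sup>2\<close>; then \<open>X X* = N\<inverse>\<close>.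
\<close>
lemma defect_roots_of_gram:
  fixes Z1 Z1' N :: "'k::chilbert_space \<Rightarrow>\<^sub>L 'k" and Z2 :: "'k \<Rightarrow>\<^sub>L 'h::chilbert_space"
    and Z2' :: "'h \<Rightarrow>\<^sub>L 'k"
  assumes fd: "finite_dimensional_vector_space (scaleC :: complex \<Rightarrow> 'k \<Rightarrow> 'k) B"
    and Z1: "adjoint_pair Z1 Z1'" "complex_linear Z1" "complex_linear Z1'"
    and Z2: "adjoint_pair Z2 Z2'" "complex_linear Z2" "complex_linear Z2'"
    and N: "adjoint_pair N N" "complex_linear N" "pos_definite N"
    and gram: "\<And>x. Z1' (Z1 x) = N x + Z2' (Z2 x)"
  obtains v :: "'h \<Rightarrow>\<^sub>L 'k" and v' :: "'k \<Rightarrow>\<^sub>L 'h" and c :: "'k \<Rightarrow>\<^sub>L 'k" and d :: "'h \<Rightarrow>\<^sub>L 'h"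
    and X X' :: "'k \<Rightarrow>\<^sub>L 'k"
  where "defect_roots v v' c d" "adjoint_pair X X'"
    "\<And>x. c x = X' (Z1' x)" "\<And>x. v x = X' (Z2' x)" "\<And>x. X (X' (N x)) = x"
proof -
  obtain e where e: "e > 0" "\<And>x. e * inner x x \<le> inner (N x) x"
    using N(3) unfolding pos_definite_def by blast
  have "sqrt e * norm x \<le> norm (Z1 x)" for x
  proof (rule power2_le_imp_le)
    have "(norm (Z1 x))\<^sup>2 = inner x (Z1' (Z1 x))"
      by (simp add: power2_norm_eq_inner adjoint_pairD[OF Z1(1)])
    also have "\<dots> = inner (N x) x + (norm (Z2 x))\<^sup>2"
      unfolding gram by (simp add: inner_add_right power2_norm_eq_inner
          adjoint_pairD[OF Z2(1)] inner_commute[of x "N x"])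
    finally have "(norm (Z1 x))\<^sup>2 = inner (N x) x + (norm (Z2 x))\<^sup>2" .
    moreover have "(sqrt e * norm x)\<^sup>2 = e * inner x x"
      using e(1) by (simp add: power_mult_distrib power2_norm_eq_inner)
    ultimately show "(sqrt e * norm x)\<^sup>2 \<le> (norm (Z1 x))\<^sup>2"
      using e(2)[of x] zero_le_power2[of "norm (Z2 x)"] by linarith
  qed simp
  then obtain z z' :: "'k \<Rightarrow>\<^sub>L 'k" where z: "adjoint_pair z z'" "complex_linear z" "complex_linear z'"
    "\<And>x. Z1 (z x) = x" "\<And>x. z (Z1 x) = x" "\<And>x. Z1' (z' x) = x" "\<And>x. z' (Z1' x) = x"
    using fin_dim_inverse[OF fd Z1, of "sqrt e"] e(1) by (metis real_sqrt_gt_0_iff)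
  obtain n :: "'k \<Rightarrow>\<^sub>L 'k" where n: "adjoint_pair n n" "complex_linear n" "\<And>x. N (n x) = x" "\<And>x. n (N x) = x"
    using pos_definite_fin_dim_inverse[OF fd N] by metis
  define A where "A = (Z1 o\<^sub>L n) o\<^sub>L Z1'"
  have A: "A x = Z1 (n (Z1' x))" for x by (simp add: A_def)
  define W where "W = (z' o\<^sub>L N) o\<^sub>L z"
  have W: "W x = z' (N (z x))" for x by (simp add: W_def)
  have WA: "W (A x) = x" and AW: "A (W x) = x" for x
    by (simp_all add: A W z n)
  have "adjoint_pair A A"
    by (simp add: adjoint_pair_def A adjoint_pairD[OF Z1(1)] adjoint_pairD[OF n(1)]
        adjoint_pairD'[OF Z1(1)])
  moreover have "complex_linear A" using Z1(2,3) n(2) by (simp add: complex_linear_def A)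
  moreover have "pos_definite A"
    unfolding pos_definite_def
  proof (intro exI conjI allI)
    define K where "K = norm (z' o\<^sub>L N) + 1"
    have K: "0 < K" by (simp add: K_def add_nonneg_pos)
    show "0 < e / K\<^sup>2" using e(1) K by simp
    fix y
    define x where "x = n (Z1' y)"
    have Nx: "N x = Z1' y" by (simp add: x_def n)
    then have y: "y = (z' o\<^sub>L N) x" by (simp add: z)
    have "norm y \<le> norm (z' o\<^sub>L N) * norm x" unfolding y by (rule norm_blinfun)
    also have "\<dots> \<le> K * norm x" by (simp add: K_def distrib_right)
    finally have "(norm y)\<^sup>2 \<le> (K * norm x)\<^sup>2" by (intro power_mono) auto
    then have "e / K\<^sup>2 * (norm y)\<^sup>2 \<le> e * (norm x)\<^sup>2"
      using K e(1) by (simp add: power_mult_distrib field_simps)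
    also have "\<dots> \<le> inner (N x) x" using e(2)[of x] by (simp add: power2_norm_eq_inner)
    also have "\<dots> = inner x (Z1' y)" unfolding Nx by (rule inner_commute)
    also have "\<dots> = inner (A y) y" by (simp add: A x_def adjoint_pairD[OF Z1(1)])
    finally show "e / K\<^sup>2 * inner y y \<le> inner (A y) y" by (simp add: power2_norm_eq_inner)
  qed
  ultimately obtain C :: "'k \<Rightarrow>\<^sub>L 'k"
    where C: "adjoint_pair C C" "pos_definite C" "complex_linear C" "\<And>x. C (C x) = A x"
    using pos_definite_csqrt_exists by metis
  have CWC: "C (W (C x)) = x" for x
  proof -
    have "C (C (W (C x)) - x) = 0" by (simp add: blinfun.diff_right C(4) AW)
    then have "C (W (C x)) - x = 0" by (rule pos_definite_injective[OF C(2)])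
    then show ?thesis by simp
  qed
  define X where "X = z o\<^sub>L C"
  define X' where "X' = C o\<^sub>L z'"
  define v where "v = X' o\<^sub>L Z2'"
  define v' where "v' = Z2 o\<^sub>L X"
  have app: "X x = z (C x)" "X' x = C (z' x)" "v h = X' (Z2' h)" "v' x = Z2 (X x)" for x h
    by (simp_all add: X_def X'_def v_def v'_def)
  have XX': "adjoint_pair X X'"
    by (simp add: adjoint_pair_def app adjoint_pairD[OF C(1)] adjoint_pairD[OF z(1)])
  have vv': "adjoint_pair v v'" "complex_linear v" "complex_linear v'"
  proof -
    show "adjoint_pair v v'"
      by (simp add: adjoint_pair_def app(3,4) adjoint_pairD'[OF XX'] adjoint_pairD'[OF Z2(1)])
    show "complex_linear v" "complex_linear v'"
      using Z2(2,3) C(3) z(2,3) by (simp_all add: complex_linear_def app)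
  qed
  obtain c d where roots: "defect_roots v v' c d"
    using defect_roots_exist[OF vv'] by blast
  have "c = C"
  proof (rule pos_definite_sqrt_unique)
    show "adjoint_pair (id_blinfun + (v o\<^sub>L v')) (id_blinfun + (v o\<^sub>L v'))"
      "pos_definite (id_blinfun + (v o\<^sub>L v'))"
      using defect_positive[OF adjoint_pair_sym[OF vv'(1)] vv'(3,2)] by blast+
    show "0 \<le> inner (c x) x" "0 \<le> inner (C x) x" for x
      by (rule pos_definite_nonneg[OF defect_rootsD(5)[OF roots]] pos_definite_nonneg[OF C(2)])+
    show "c (c x) = (id_blinfun + (v o\<^sub>L v')) x" for x
      by (simp add: blinfun.add_left defect_rootsD(7)[OF roots])
    show "C (C x) = (id_blinfun + (v o\<^sub>L v')) x" for x
    proof -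
      have "Z2' (Z2 (X x)) = Z1' (Z1 (X x)) - N (X x)" by (simp add: gram)
      then have "v (v' x) = C (C x) - C (W (C x))"
        by (simp add: app W z blinfun.diff_right)
      then show ?thesis by (simp add: CWC blinfun.add_left)
    qed
  qed
  show thesis
  proof (rule that[OF roots XX'])
    show "c x = X' (Z1' x)" for x by (simp add: \<open>c = C\<close> app z)
    show "v h = X' (Z2' h)" for h by (rule app)
    show "X (X' (N x)) = x" for x
      by (simp add: app C(4) A z n)
  qed
qed

lemma op_dist_midpoint:
  fixes t1 t2 :: "'h::chilbert_space \<Rightarrow>\<^sub>L 'k::chilbert_space"
  assumes fd: "finite_dimensional_vector_space (scaleC :: complex \<Rightarrow> 'k \<Rightarrow> 'k) B"
    and 1: "defect_roots t1 t1' c1 d1" and 2: "defect_roots t2 t2' c2 d2"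
  obtains v :: "'h \<Rightarrow>\<^sub>L 'k" and v' :: "'k \<Rightarrow>\<^sub>L 'h" and c :: "'k \<Rightarrow>\<^sub>L 'k" and d :: "'h \<Rightarrow>\<^sub>L 'h"
  where "defect_roots v v' c d"
    "op_dist (op_graph v) (op_graph t1) \<le> op_dist (op_graph t1) (op_graph t2) / 2"
    "op_dist (op_graph v) (op_graph t2) \<le> op_dist (op_graph t1) (op_graph t2) / 2"
proof -
  let ?\<delta> = "op_dist (op_graph t1) (op_graph t2)"
  have \<delta>: "0 \<le> ?\<delta>" by (rule op_dist_nonneg[OF 1 2])
  define R where "R = R_map c1 t1 c2 t2'"
  define R' where "R' = R_map c2 t2 c1 t1'"
  have R: "R x = c1 (c2 x) - t1 (t2' x)" and R': "R' x = c2 (c1 x) - t2 (t1' x)" for x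
    by (simp_all add: R_def R'_def R_map_apply)
  have RR': "adjoint_pair R R'" unfolding R_def R'_def by (rule adjoint_pair_R_map[OF 1 2])
  have clinR: "complex_linear R" "complex_linear R'"
    using defect_rootsD(2,3,6)[OF 1] defect_rootsD(2,3,6)[OF 2]
    by (simp_all add: complex_linear_def R R' scaleC_diff_right)
  have expand: "norm x \<le> norm (R x)" "norm x \<le> norm (R' x)" for x
    by (rule power2_le_imp_le; simp add: R_def R'_def norm_R_map[OF 1 2] norm_R_map[OF 2 1])+
  have R'_le: "norm (R' x) \<le> cosh ?\<delta> * norm x" for x
    using op_dist_le_iff[OF 2 1 \<delta>] op_dist_commute[OF 1 2] unfolding R'_def by simp
  obtain g g' :: "'k \<Rightarrow>\<^sub>L 'k" where g: "adjoint_pair g g'" "complex_linear g" "complex_linear g'"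
    "\<And>x. R (g x) = x" "\<And>x. g (R x) = x" "\<And>x. R' (g' x) = x" "\<And>x. g' (R' x) = x"
    using fin_dim_inverse[OF fd RR' clinR, of 1] expand(1) by (metis mult_1 zero_less_one)
  have "adjoint_pair (R o\<^sub>L R') (R o\<^sub>L R')"
    by (simp add: adjoint_pair_def adjoint_pairD[OF RR'] adjoint_pairD'[OF RR'])
  moreover have "complex_linear (R o\<^sub>L R')" using clinR by (simp add: complex_linear_def)
  moreover have "pos_definite (R o\<^sub>L R')"
    unfolding pos_definite_def
  proof (intro exI conjI allI)
    show "1 * inner x x \<le> inner ((R o\<^sub>L R') x) x" for x
      using power_mono[OF expand(2)[of x], of 2]
      by (simp add: adjoint_pairD[OF RR'] flip: power2_norm_eq_inner)
  qed simp
  ultimately obtain P :: "'k \<Rightarrow>\<^sub>L 'k"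
    where P: "adjoint_pair P P" "pos_definite P" "complex_linear P" "\<And>x. P (P x) = R (R' x)"
    using pos_definite_csqrt_exists[of "R o\<^sub>L R'"] by auto
  have P_le: "norm (P x) \<le> cosh ?\<delta> * norm x" for x
  proof -
    have "(norm (P x))\<^sup>2 = (norm (R' x))\<^sup>2"
      by (simp add: power2_norm_eq_inner adjoint_pairD[OF P(1)] P(4) adjoint_pairD'[OF RR'])
    then show ?thesis using R'_le[of x] by simp
  qed
  define Q where "Q = g o\<^sub>L P"
  define Q' where "Q' = P o\<^sub>L g'"
  have Qa: "Q x = g (P x)" and Q'a: "Q' x = P (g' x)" for x by (simp_all add: Q_def Q'_def)
  have QQ': "adjoint_pair Q Q'"
    by (simp add: adjoint_pair_def Qa Q'a adjoint_pairD[OF g(1)] adjoint_pairD[OF P(1)])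
  have clinQ: "complex_linear Q" "complex_linear Q'" using g(2,3) P(3) by (simp_all add: complex_linear_def Qa Q'a)
  have RQ: "R (Q x) = P x" and Q'R': "Q' (R' x) = P x" and QQ'_id: "Q (Q' x) = x" for x
    by (simp_all add: Qa Q'a P(4) g)
  have Q'Q_id: "Q' (Q x) = x" for x
  proof -
    have "P (Q' (Q x) - x) = 0"
      by (simp add: blinfun.diff_right Qa Q'a P(4) g)
    then show ?thesis using pos_definite_injective[OF P(2)] by fastforce
  qed
  define N where "N = 2 *\<^sub>R (id_blinfun + P)"
  have Na: "N x = 2 *\<^sub>R (x + P x)" for x by (simp add: N_def blinfun.add_left blinfun.scaleR_left)
  have N: "adjoint_pair N N" "complex_linear N" "pos_definite N"
  proof -
    show "adjoint_pair N N"
      by (simp add: adjoint_pair_def Na inner_add_left inner_add_right adjoint_pairD[OF P(1)])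
    show "complex_linear N"
      using P(3) by (simp add: complex_linear_def Na scaleR_scaleC scaleC_scaleC mult.commute flip: scaleC_add_right)
    show "pos_definite N"
      unfolding pos_definite_def
      by (rule exI[of _ 2]) (simp add: Na inner_add_left pos_definite_nonneg[OF P(2)])
  qed
  define Z1 where "Z1 = c1 + (c2 o\<^sub>L Q)"
  define Z1' where "Z1' = c1 + (Q' o\<^sub>L c2)"
  define Z2 where "Z2 = t1' + (t2' o\<^sub>L Q)"
  define Z2' where "Z2' = t1 + (Q' o\<^sub>L t2)"
  have Za: "Z1 x = c1 x + c2 (Q x)" "Z1' x = c1 x + Q' (c2 x)"
    "Z2 x = t1' x + t2' (Q x)" "Z2' h = t1 h + Q' (t2 h)" for x h
    by (simp_all add: Z1_def Z1'_def Z2_def Z2'_def blinfun.add_left)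
  have Z1: "adjoint_pair Z1 Z1'" "complex_linear Z1" "complex_linear Z1'"
    using defect_rootsD(6)[OF 1] defect_rootsD(6)[OF 2] clinQ
    by (simp_all add: adjoint_pair_def complex_linear_def Za scaleC_add_right inner_add_left inner_add_right
        adjoint_pairD[OF defect_rootsD(4)[OF 1]] adjoint_pairD[OF defect_rootsD(4)[OF 2]]
        adjoint_pairD[OF QQ'])
  have Z2: "adjoint_pair Z2 Z2'" "complex_linear Z2" "complex_linear Z2'"
    using defect_rootsD(2,3)[OF 1] defect_rootsD(2,3)[OF 2] clinQ
    by (simp_all add: adjoint_pair_def complex_linear_def Za scaleC_add_right inner_add_left inner_add_right
        adjoint_pairD'[OF defect_rootsD(1)[OF 1]] adjoint_pairD'[OF defect_rootsD(1)[OF 2]]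
        adjoint_pairD[OF QQ'])
  have col1: "Z1' (c1 x) - Z2' (t1' x) = x + P x" for x
  proof -
    have "Z1' (c1 x) - Z2' (t1' x) = x + Q' (R' x)"
      by (simp add: Za R' blinfun.bilinear_simps defect_rootsD(7)[OF 1])
    then show ?thesis by (simp add: Q'R')
  qed
  have col2: "Z1' (c2 x) - Z2' (t2' x) = Q' x + P (Q' x)" for x
  proof -
    have "Z1' (c2 x) - Z2' (t2' x) = R x + Q' x"
      by (simp add: Za R blinfun.bilinear_simps defect_rootsD(7)[OF 2])
    also have "R x = P (Q' x)" by (metis RQ QQ'_id)
    finally show ?thesis by (simp add: add.commute)
  qed
  have gram: "Z1' (Z1 x) = N x + Z2' (Z2 x)" for x
  proof -
    have "Z1' (Z1 x) - Z2' (Z2 x) =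
        (Z1' (c1 x) - Z2' (t1' x)) + (Z1' (c2 (Q x)) - Z2' (t2' (Q x)))"
      unfolding Za(1,3) by (simp add: blinfun.add_right)
    also have "\<dots> = N x" unfolding col1 col2 by (simp add: Na Q'Q_id scaleR_2)
    finally show ?thesis by (simp add: algebra_simps)
  qed
  obtain v :: "'h \<Rightarrow>\<^sub>L 'k" and v' :: "'k \<Rightarrow>\<^sub>L 'h" and c :: "'k \<Rightarrow>\<^sub>L 'k" and d :: "'h \<Rightarrow>\<^sub>L 'h"
      and X X' :: "'k \<Rightarrow>\<^sub>L 'k"
    where roots: "defect_roots v v' c d" and XX': "adjoint_pair X X'"
    and c: "\<And>x. c x = X' (Z1' x)" and v: "\<And>x. v x = X' (Z2' x)" and XX'N: "\<And>x. X (X' (N x)) = x"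
    using defect_roots_of_gram[OF fd Z1 Z2 N gram] by metis
  have half: "norm (X' (x + P x)) \<le> cosh (?\<delta> / 2) * norm x" for x
  proof (rule power2_le_imp_le)
    let ?u = "x + P x"
    have "?u = (1/2) *\<^sub>R N x" by (simp add: Na)
    then have "X (X' ?u) = (1/2) *\<^sub>R x" by (simp add: XX'N blinfun.scaleR_right)
    then have "(norm (X' ?u))\<^sup>2 = (1/2) * (inner x x + inner x (P x))"
      using adjoint_pairD[OF XX', of "X' ?u" ?u]
      by (simp add: power2_norm_eq_inner inner_add_right)
    also have "inner x (P x) \<le> norm x * norm (P x)" by (rule norm_cauchy_schwarz)
    also have "\<dots> \<le> norm x * (cosh ?\<delta> * norm x)" by (intro mult_left_mono P_le) simp
    also have "1/2 * (inner x x + norm x * (cosh ?\<delta> * norm x)) = (1 + cosh ?\<delta>) / 2 * (norm x)\<^sup>2"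
      by (simp add: power2_norm_eq_inner[symmetric] power2_eq_square field_simps)
    also have "(1 + cosh ?\<delta>) / 2 = (cosh (?\<delta> / 2))\<^sup>2"
      using cosh_double_cosh[of "?\<delta> / 2"] by simp
    finally show "(norm (X' ?u))\<^sup>2 \<le> (cosh (?\<delta> / 2) * norm x)\<^sup>2"
      by (simp add: power_mult_distrib)
  qed simp
  show thesis
  proof (rule that[OF roots])
    have "R_map c v c1 t1' x = X' (x + P x)" for x
      unfolding R_map_apply c v col1[symmetric] by (simp add: blinfun.diff_right)
    then show "op_dist (op_graph v) (op_graph t1) \<le> ?\<delta> / 2"
      by (intro op_dist_le_iff[OF roots 1, THEN iffD2]) (use half \<delta> in simp_all)
    have "norm (Q' x) = norm x" for x
    proof -
      have "(norm (Q' x))\<^sup>2 = (norm x)\<^sup>2"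
        by (simp add: power2_norm_eq_inner adjoint_pairD'[OF QQ'] QQ'_id)
      then show ?thesis by simp
    qed
    moreover have "R_map c v c2 t2' x = X' (Q' x + P (Q' x))" for x
      unfolding R_map_apply c v col2[symmetric] by (simp add: blinfun.diff_right)
    ultimately show "op_dist (op_graph v) (op_graph t2) \<le> ?\<delta> / 2"
      by (intro op_dist_le_iff[OF roots 2, THEN iffD2]) (use half \<delta> in \<open>simp, metis\<close>)
  qed
qed

theorem corollary3p6:
  fixes B :: "'k::chilbert_space set"
  assumes "finite_dimensional_vector_space (scaleC :: complex \<Rightarrow> 'k \<Rightarrow> 'k) B"
  shows "metrically_convex (closed_ops :: ('h::chilbert_space \<times> 'k) set set) op_dist"
proof -
  have roots: "\<exists>(t :: 'h \<Rightarrow>\<^sub>L 'k) (t' :: 'k \<Rightarrow>\<^sub>L 'h) c d. T = op_graph (blinfun_apply t) \<and> defect_roots t t' c d"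
    if T: "T \<in> closed_ops" for T :: "('h \<times> 'k) set"
  proof -
    obtain t :: "'h \<Rightarrow>\<^sub>L 'k" and t' :: "'k \<Rightarrow>\<^sub>L 'h"
      where t: "adjoint_pair t t'" "complex_linear t" "complex_linear t'" "T = op_graph t"
      using closed_ops_bounded[OF assms T] by blast
    then show ?thesis using defect_roots_exist[OF t(1-3)] by metis
  qed
  interpret Metric_space "closed_ops :: ('h \<times> 'k) set set" op_dist
  proof
    fix T S U :: "('h \<times> 'k) set"
    have *: "0 \<le> op_dist T S \<and> op_dist T S = op_dist S T \<and> (op_dist T S = 0 \<longleftrightarrow> T = S)"
      if TS: "T \<in> closed_ops" "S \<in> closed_ops"
    proof -
      obtain t1 t2 :: "'h \<Rightarrow>\<^sub>L 'k" and t1' t2' :: "'k \<Rightarrow>\<^sub>L 'h" and c1 d1 c2 d2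
        where 1: "T = op_graph t1" "defect_roots t1 t1' c1 d1"
          and 2: "S = op_graph t2" "defect_roots t2 t2' c2 d2"
        using roots[OF TS(1)] roots[OF TS(2)] by blast
      show ?thesis
        unfolding 1(1) 2(1) op_graph_eq_iff blinfun_apply_inject op_dist_eq_0_iff[OF 1(2) 2(2)]
        using op_dist_nonneg[OF 1(2) 2(2)] op_dist_commute[OF 1(2) 2(2)] by blast
    qed
    show "0 \<le> op_dist T S"
      using * by (cases "T \<in> closed_ops \<and> S \<in> closed_ops") (auto simp: op_dist_def)
    show "op_dist T S = op_dist S T"
      using * by (cases "T \<in> closed_ops \<and> S \<in> closed_ops") (auto simp: op_dist_def)
    show "op_dist T S = 0 \<longleftrightarrow> T = S" if "T \<in> closed_ops" "S \<in> closed_ops"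
      using * that by blast
    show "op_dist T U \<le> op_dist T S + op_dist S U"
      if "T \<in> closed_ops" "S \<in> closed_ops" "U \<in> closed_ops"
      using roots[OF that(1)] roots[OF that(2)] roots[OF that(3)] op_dist_triangle by blast
  qed
  have "\<exists>V\<in>closed_ops. V \<noteq> T \<and> V \<noteq> S \<and> op_dist T S = op_dist T V + op_dist V S"
    if TS: "T \<in> closed_ops" "S \<in> closed_ops" "T \<noteq> S" for T S :: "('h \<times> 'k) set"
  proof -
    obtain t1 t2 :: "'h \<Rightarrow>\<^sub>L 'k" and t1' t2' :: "'k \<Rightarrow>\<^sub>L 'h" and c1 d1 c2 d2
      where 1: "T = op_graph t1" "defect_roots t1 t1' c1 d1"
        and 2: "S = op_graph t2" "defect_roots t2 t2' c2 d2"
      using roots[OF TS(1)] roots[OF TS(2)] by blast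
    obtain v :: "'h \<Rightarrow>\<^sub>L 'k" and v' :: "'k \<Rightarrow>\<^sub>L 'h" and c :: "'k \<Rightarrow>\<^sub>L 'k" and d :: "'h \<Rightarrow>\<^sub>L 'h"
      where v: "defect_roots v v' c d"
      "op_dist (op_graph v) T \<le> op_dist T S / 2" "op_dist (op_graph v) S \<le> op_dist T S / 2"
      unfolding 1(1) 2(1) by (rule op_dist_midpoint[OF assms 1(2) 2(2)])
    have V: "op_graph v \<in> closed_ops"
      by (rule op_graph_closed_ops[OF defect_rootsD(2)[OF v(1)]])
    have "0 < op_dist T S" using TS nonneg[of T S] zero[OF TS(1,2)] by linarith
    moreover have "op_dist T S \<le> op_dist (op_graph v) T + op_dist (op_graph v) S"
      using triangle[OF TS(1) V TS(2)] by (simp add: commute)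
    ultimately have "op_dist (op_graph v) T = op_dist T S / 2" "op_dist (op_graph v) S = op_dist T S / 2"
      using v(2,3) by linarith+
    then show ?thesis
      using V \<open>0 < op_dist T S\<close> zero[OF V TS(1)] zero[OF V TS(2)]
      by (intro bexI[of _ "op_graph v"]) (auto simp: commute[of T])
  qed
  then show ?thesis
    unfolding metrically_convex_def using Metric_space_axioms by blast
qed

end
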